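(* Let $r,s$ be real numbers with $s=r<0$, let $G$ be a finite group and let $n$ be a positive divisor of $|G|$. Then $T_{G,n}(r,s)\ge 0$, with equality if and only if $G$ contains exactly one subgroup of order $n$ and this subgroup is nilpotent. In particular (taking $n=|G|$), for every real $r<0$ and every finite group $G$ of order $N$, $\sum_{x\in G}\left(\frac{o(x)}{\varphi(o(x))}\right)^r \ge \sum_{x\in C_N}\left(\frac{o(x)}{\varphi(o(x))}\right)^r$, with equality if and only if $G$ is nilpotent.
   Context: $o(x)$ is the order of $x$, $\varphi$ is Euler's totient function, and $C_N$ is the cyclic group of order $N$. For a finite group $G$, a positive divisor $n$ of $|G|$ and reals $r,s$, define $R_{G,n}(r,s) := \sum_{x\in G,\ o(x)\mid n} \frac{o(x)^s}{\varphi(o(x))^r}$ and $T_{G,n}(r,s) := R_{G,n}(r,s) - R_{C_{|G|},n}(r,s)$. *)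

theory Defs
  imports Complex_Main "HOL-Algebra.Algebra" "HOL-Number_Theory.Number_Theory"
begin

fun lower_central :: "('a, 'b) monoid_scheme \<Rightarrow> nat \<Rightarrow> 'a set" where
  "lower_central G 0 = carrier G"
| "lower_central G (Suc i) =
     generate G (\<Union>h \<in> lower_central G i. \<Union>g \<in> carrier G.
        { h \<otimes>\<^bsub>G\<^esub> g \<otimes>\<^bsub>G\<^esub> inv\<^bsub>G\<^esub> h \<otimes>\<^bsub>G\<^esub> inv\<^bsub>G\<^esub> g })"

definition nilpotent_group :: "('a, 'b) monoid_scheme \<Rightarrow> bool" where
  "nilpotent_group G \<longleftrightarrow> group G \<and> (\<exists>i. lower_central G i = {\<one>\<^bsub>G\<^esub>})"

definition R_sum :: "('a, 'b) monoid_scheme \<Rightarrow> nat \<Rightarrow> real \<Rightarrow> real \<Rightarrow> real" where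
  "R_sum G n r s = (\<Sum>x \<in> {x \<in> carrier G. group.ord G x dvd n}.
      real (group.ord G x) powr s / real (totient (group.ord G x)) powr r)"

abbreviation cyclic_group :: "nat \<Rightarrow> int monoid" where
  "cyclic_group N \<equiv> integer_mod_group N"

definition T_diff :: "('a, 'b) monoid_scheme \<Rightarrow> nat \<Rightarrow> real \<Rightarrow> real \<Rightarrow> real" where
  "T_diff G n r s = R_sum G n r s - R_sum (cyclic_group (order G)) n r s"

end

(* For r < 0 the summand (o(x) / phi(o(x)))^r is the product of c_p = (1 - 1/p)^(-r) over the primes
   p dividing o(x), with 0 < c_p < 1. Writing c_p + (1 - c_p) = 1 for the other primes dividing n and
   expanding, the sum becomes a positive combination, over the sets A of prime divisors of n, of the
   numbers of solutions of x^m = 1, where m is the A-part of n. By Frobenius' theorem each of these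
   numbers is at least m, with equality in the cyclic group. Equality for all A amounts to equality
   for all maximal prime powers q dividing n; then the solutions of x^q = 1 form normal subgroups of
   order q, whose product is the unique subgroup of order n, and it is nilpotent. Conversely, if H is
   the unique subgroup of order n = q m and is nilpotent, then a p-element y outside H with y^q = 1
   and y^p in H lies in a subgroup of order q of the p-group generated by y and the Sylow p-subgroup
   of H; its product with the Hall subgroup of order m of H would be a second subgroup of order n.

   Frobenius' theorem is proved by the induction of Isaacs and Robinson, first on the order of the
   group and then on its quotient by m. *)
theory Submission
  imports Defs
begin

subsection \<open>Solutions of \<open>x ^ m = 1\<close>\<close>

text \<open>The weights in the expansion depend only on r and n, so they are shared by
  \<open>G\<close> and the cyclic group; the difference is then a sum of nonnegative terms and
  vanishes only if each term does. Equality of counts becomes structure through Sylow's existence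
  theorem for every prime power q dividing |G|: a subgroup of order q consists of solutions of x^q =
  1, so if there are only q solutions, they are that subgroup.

  In Frobenius' theorem with m = s p^k and p not dividing s, the induction reduces the claim to the
  number of elements that solve x^(m p) = 1 but not x^m = 1. The two coprime factors of m need
  different reasons: p^k comes from counting generators of cyclic subgroups, s from conjugacy
  classes of p-parts and quotients of centralizers.

  Nilpotency is defined by the descending central series, but it is proved here by exhibiting
  elements that are central modulo a normal subgroup. The ascending series connects the two; the
  descending one is used directly only to make normalizers grow.\<close>

definition pow_roots :: "('a, 'b) monoid_scheme \<Rightarrow> nat \<Rightarrow> 'a set" where
  "pow_roots G m = {x \<in> carrier G. x [^]\<^bsub>G\<^esub> m = \<one>\<^bsub>G\<^esub>}"

lemma finite_pow_roots: "finite (carrier G) \<Longrightarrow> finite (pow_roots G m)"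
  by (simp add: pow_roots_def)

lemma pow_roots_carrier_update:
  "H \<subseteq> carrier G \<Longrightarrow> pow_roots (G\<lparr>carrier := H\<rparr>) m = pow_roots G m \<inter> H"
  by (auto simp: pow_roots_def nat_pow_def)

lemma (in group) mem_pow_roots_iff: "x \<in> pow_roots G m \<longleftrightarrow> x \<in> carrier G \<and> ord x dvd m"
  by (auto simp: pow_roots_def pow_eq_id)

lemma (in group) pow_roots_gcd_order: "pow_roots G (gcd m (order G)) = pow_roots G m"
  using ord_dvd_group_order by (auto simp: mem_pow_roots_iff)

lemma card_pow_roots_iso:
  assumes "h \<in> iso G H" "group G" "group H"
  shows "card (pow_roots G m) = card (pow_roots H m)"
proof -
  interpret group_hom G H h
    using assms by (simp add: group_hom_def group_hom_axioms_def iso_def)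
  have b: "bij_betw h (carrier G) (carrier H)" using assms by (simp add: iso_def)
  have "bij_betw h (pow_roots G m) (pow_roots H m)"
  proof (rule bij_betw_subset[OF b])
    show "pow_roots G m \<subseteq> carrier G" by (auto simp: pow_roots_def)
    have "h y = \<one>\<^bsub>H\<^esub> \<longleftrightarrow> y = \<one>\<^bsub>G\<^esub>" if "y \<in> carrier G" for y
      using that inj_onD[OF bij_betw_imp_inj_on[OF b], of y "\<one>\<^bsub>G\<^esub>"] by auto
    then have *: "h x [^]\<^bsub>H\<^esub> m = \<one>\<^bsub>H\<^esub> \<longleftrightarrow> x [^]\<^bsub>G\<^esub> m = \<one>\<^bsub>G\<^esub>" if "x \<in> carrier G" for x
      using that by (simp flip: hom_nat_pow)
    show "h ` pow_roots G m = pow_roots H m"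
      using * unfolding pow_roots_def bij_betw_imp_surj_on[OF b, symmetric] by auto
  qed
  then show ?thesis by (rule bij_betw_same_card)
qed

section \<open>Splitting an element by coprime exponents\<close>

lemma (in group) pow_cong:
  assumes "x \<in> carrier G" "x [^] m = \<one>" "[i = j] (mod m)"
  shows "x [^] i = x [^] (j :: nat)"
proof -
  have "x [^] k = x [^] (k mod m)" for k
  proof -
    have "x [^] k = x [^] (m * (k div m) + k mod m)" by simp
    also have "\<dots> = (x [^] m) [^] (k div m) \<otimes> x [^] (k mod m)"
      using assms(1) by (metis nat_pow_mult nat_pow_pow)
    finally show ?thesis using assms by simp
  qed
  then show ?thesis using assms(3) by (metis cong_def)
qed

text \<open>\<open>c\<close> and \<open>d\<close> are the idempotents of the Chinese remainder
  theorem: if the order of x divides \<open>a * b\<close>, then x^c and x^d are its parts of order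
  dividing \<open>a\<close> and \<open>b\<close>, and their product is x.\<close>

lemma coprime_exponents:
  fixes a b :: nat
  assumes "coprime a b"
  obtains c d where "[c = 1] (mod a)" "b dvd c" "[d = 1] (mod b)" "a dvd d"
    "[c + d = 1] (mod a * b)"
proof -
  obtain c where c: "[c = 1] (mod a)" "[c = 0] (mod b)"
    using binary_chinese_remainder_nat[OF assms] by blast
  obtain d where d: "[d = 0] (mod a)" "[d = 1] (mod b)"
    using binary_chinese_remainder_nat[OF assms] by blast
  have "[c + d = 1 + 0] (mod a)" "[c + d = 0 + 1] (mod b)"
    using c d by (intro cong_add; simp)+
  then have "[c + d = 1] (mod a * b)"
    using coprime_cong_mult_nat assms by force
  then show ?thesis using c d that by (simp add: cong_0_iff)
qed

section \<open>Counting by cyclic subgroups\<close>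

lemma dvd_sum_fibers:
  fixes g :: "'a \<Rightarrow> nat"
  assumes "finite S" "\<And>x. x \<in> S \<Longrightarrow> q dvd (\<Sum>y | y \<in> S \<and> f y = f x. g y)"
  shows "q dvd sum g S"
  unfolding sum.image_gen[OF assms(1), of g f] by (rule dvd_sum) (use assms(2) in auto)

text \<open>A power x^k generates the same subgroup as x exactly when k is coprime to o(x), and
  distinct totatives of o(x) give distinct powers.\<close>

lemma (in group) card_generators:
  assumes "finite (carrier G)" "x \<in> carrier G"
  shows "card {y \<in> carrier G. generate G {y} = generate G {x}} = totient (ord x)"
proof -
  let ?o = "ord x"
  have o: "?o \<ge> 1" using ord_ge_1 assms by blast
  have "{y \<in> carrier G. generate G {y} = generate G {x}} = (\<lambda>k. x [^] k) ` totatives ?o"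
  proof (intro equalityI subsetI)
    fix y assume "y \<in> {y \<in> carrier G. generate G {y} = generate G {x}}"
    then have y: "y \<in> carrier G" "generate G {y} = generate G {x}" by auto
    then have oy: "ord y = ?o" using generate_pow_card assms by metis
    have "y \<in> generate G {x}" using y(2) generate.incl[of y "{y}" G] by auto
    then have "y \<in> {x [^] k |k. k \<in> {0..?o - 1}}"
      using generate_pow_on_finite_carrier[OF assms] ord_elems[OF assms] by blast
    then obtain k where k: "y = x [^] k" "k \<le> ?o - 1" by (auto simp del: One_nat_def)
    show "y \<in> (\<lambda>k. x [^] k) ` totatives ?o"
    \<comment> \<open>The exponents from \<open>ord_elems\<close> start at 0, the totatives at 1.
      Exponent 0 gives a generator only if o(x) = 1, and then exponent 1 names the same
      element.\<close>
    proof (cases "k = 0")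
      case True
      then have "?o = 1" using k oy ord_id by simp
      then have "y = x [^] (1::nat)" "1 \<in> totatives ?o" using k True assms ord_eq_1 by auto
      then show ?thesis by (rule image_eqI)
    next
      case False
      have "coprime k ?o" using k oy pow_ord_eq_ord_iff[OF assms] by simp
      then have "k \<in> totatives ?o" using False k(2) o by (simp add: in_totatives_iff)
      with k(1) show ?thesis by (rule image_eqI)
    qed
  next
    fix y assume "y \<in> (\<lambda>k. x [^] k) ` totatives ?o"
    then obtain k where k: "y = x [^] k" "coprime k ?o" by (auto simp: in_totatives_iff)
    have y: "y \<in> carrier G" using k assms by simp
    have "ord y = ?o" using pow_ord_eq_ord_iff[OF assms] k by simp
    then have "card (generate G {y}) = card (generate G {x})"
      using generate_pow_card y assms by metis
    moreover have "generate G {y} \<subseteq> generate G {x}"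
      using k generate_pow_on_finite_carrier[OF assms] y assms
      by (intro generate_subgroup_incl generate_is_subgroup) auto
    moreover have "finite (generate G {x})"
      using assms generate_incl[of "{x}"] by (meson empty_subsetI finite_subset insert_subset)
    ultimately show "y \<in> {y \<in> carrier G. generate G {y} = generate G {x}}"
      using y by (simp add: card_subset_eq)
  qed
  moreover have "inj_on (\<lambda>k. x [^] k) (totatives ?o)"
    by (rule inj_on_subset[OF ord_inj'[OF assms(2)]]) (auto simp: in_totatives_iff)
  ultimately show ?thesis by (simp add: card_image totient_def)
qed

text \<open>\<open>S\<close> is a union of classes of elements generating the same cyclic subgroup,
  and the class of x has phi(o(x)) members.\<close>

lemma (in group) dvd_card_of_dvd_totient:
  assumes fin: "finite (carrier G)" and S: "S \<subseteq> carrier G"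
    and closed: "\<And>x y. x \<in> S \<Longrightarrow> y \<in> carrier G \<Longrightarrow> ord y = ord x \<Longrightarrow> y \<in> S"
    and dvd: "\<And>x. x \<in> S \<Longrightarrow> q dvd totient (ord x)"
  shows "q dvd card S"
proof -
  have "q dvd (\<Sum>y | y \<in> S \<and> generate G {y} = generate G {x}. 1)" if x: "x \<in> S" for x
  proof -
    have xc: "x \<in> carrier G" using x S by auto
    have "y \<in> S" if "y \<in> carrier G" "generate G {y} = generate G {x}" for y
      using closed[OF x] generate_pow_card[OF xc] generate_pow_card[OF that(1)] that by simp
    then have "{y. y \<in> S \<and> generate G {y} = generate G {x}}
        = {y \<in> carrier G. generate G {y} = generate G {x}}"
      using S by blast
    then show ?thesis using card_generators[OF fin xc] dvd[OF x] by simp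
  qed
  then have "q dvd (\<Sum>y\<in>S. 1)"
    by (rule dvd_sum_fibers[where f = "\<lambda>y. generate G {y}", OF finite_subset[OF S fin]])
  then show ?thesis by simp
qed

section \<open>Quotients by normal and central subgroups\<close>

lemma (in normal) order_FactGroup: "order (G Mod H) * card H = order G"
  using lagrange[OF is_subgroup] by (simp add: order_def FactGroup_def)

lemma (in normal) FactGroup_eq_one_iff: "x \<in> carrier G \<Longrightarrow> H #> x = H \<longleftrightarrow> x \<in> H"
  using coset_join1[OF _ _ is_subgroup] coset_join2[OF _ is_subgroup] by metis

text \<open>Every coset that solves the equation in the quotient contains exactly one solution. Two
  of them differ by some h in \<open>N\<close> with h^s = 1, which is trivial because |N| is coprime
  to \<open>s\<close>; and a representative w can be corrected to a solution by taking a suitable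
  power.\<close>

lemma (in group) card_pow_roots_central_quotient:
  assumes "N \<lhd> G" and central: "\<And>h g. h \<in> N \<Longrightarrow> g \<in> carrier G \<Longrightarrow> h \<otimes> g = g \<otimes> h"
    and cop: "coprime (card N) s"
  shows "card (pow_roots (G Mod N) s) = card (pow_roots G s)"
proof -
  interpret N: normal N G by fact
  interpret NG: group "G\<lparr>carrier := N\<rparr>" by (rule N.subgroup_is_group[OF is_group])
  have N_pow: "h [^] card N = \<one>" if "h \<in> N" for h
    using NG.pow_order_eq_1[of h] that by (simp add: order_def nat_pow_def)
  have "bij_betw (\<lambda>z. N #> z) (pow_roots G s) (pow_roots (G Mod N) s)"
    unfolding bij_betw_def
  proof (intro conjI inj_onI equalityI subsetI)
    fix z w assume z: "z \<in> pow_roots G s" and w: "w \<in> pow_roots G s" and eq: "N #> z = N #> w"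
    then have zc: "z \<in> carrier G" "z [^] s = \<one>" "w \<in> carrier G" "w [^] s = \<one>"
      by (auto simp: pow_roots_def)
    then obtain h where h: "h \<in> N" "z = h \<otimes> w"
      using eq repr_independenceD[OF N.is_subgroup, of z w] rcos_self[OF _ N.is_subgroup, of z]
      by (auto simp: r_coset_def)
    have hc: "h \<in> carrier G" using h N.subset by auto
    have "z [^] s = h [^] s \<otimes> w [^] s"
      unfolding h(2) by (rule pow_mult_distrib[OF central[OF h(1) zc(3)] hc zc(3)])
    then have "h [^] s = \<one>" using zc hc by (metis nat_pow_closed r_one)
    then have "ord h dvd s" "ord h dvd card N" using N_pow h hc by (auto simp: pow_eq_id)
    then have "ord h = 1" using coprime_common_divisor_nat[OF cop] by simp
    then show "z = w" using h hc zc ord_eq_1 by simp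
  next
    fix A assume "A \<in> (\<lambda>z. N #> z) ` pow_roots G s"
    then obtain z where "z \<in> carrier G" "z [^] s = \<one>" "A = N #> z" by (auto simp: pow_roots_def)
    then show "A \<in> pow_roots (G Mod N) s"
      using N.FactGroup_pow[of z s] N.subset by (auto simp: pow_roots_def carrier_FactGroup)
  next
    fix A assume "A \<in> pow_roots (G Mod N) s"
    then obtain w where w: "w \<in> carrier G" "A = N #> w" "A [^]\<^bsub>G Mod N\<^esub> s = N"
      by (auto simp: pow_roots_def carrier_FactGroup)
    then have ws: "w [^] s \<in> N"
      using N.FactGroup_pow[of w s] N.FactGroup_eq_one_iff[of "w [^] s"] by simp
    \<comment> \<open>As a multiple of |N|, the exponent \<open>d\<close> turns w^s, an element of
      \<open>N\<close>, into the identity. As \<open>d\<close> is 1 modulo \<open>s\<close>, the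
      power w^d stays in the coset of w.\<close>
    obtain c d where cd: "[d = 1] (mod s)" "card N dvd d"
      using coprime_exponents[OF cop] by metis
    have "(w [^] d) [^] s = ((w [^] s) [^] card N) [^] (d div card N)"
      using w dvd_mult_div_cancel[OF cd(2)] by (simp add: nat_pow_pow ac_simps)
    then have "w [^] d \<in> pow_roots G s" using N_pow[OF ws] w by (simp add: pow_roots_def)
    moreover have "N #> w [^] d = A"
    proof -
      interpret Q: group "G Mod N" by (rule N.factorgroup_is_group)
      have A: "A \<in> carrier (G Mod N)" using w by (auto simp: carrier_FactGroup)
      have "N #> w [^] d = A [^]\<^bsub>G Mod N\<^esub> d" using N.FactGroup_pow w by simp
      also have "\<dots> = A [^]\<^bsub>G Mod N\<^esub> (1::nat)"
        using w by (intro Q.pow_cong[OF A _ cd(1)]) simp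
      finally show ?thesis using Q.nat_pow_eone[OF A] by simp
    qed
    ultimately show "A \<in> (\<lambda>z. N #> z) ` pow_roots G s" by blast
  qed
  then show ?thesis by (simp add: bij_betw_same_card)
qed

subsection \<open>Frobenius' theorem\<close>

abbreviation conj_action :: "('a, 'b) monoid_scheme \<Rightarrow> 'a \<Rightarrow> 'a \<Rightarrow> 'a" where
  "conj_action G \<equiv> \<lambda>g. \<lambda>h \<in> carrier G. g \<otimes>\<^bsub>G\<^esub> h \<otimes>\<^bsub>G\<^esub> inv\<^bsub>G\<^esub> g"

definition centralizer :: "('a, 'b) monoid_scheme \<Rightarrow> 'a \<Rightarrow> 'a set" where
  "centralizer G y = {g \<in> carrier G. g \<otimes>\<^bsub>G\<^esub> y = y \<otimes>\<^bsub>G\<^esub> g}"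

lemma (in group) conj_eq_iff:
  "g \<in> carrier G \<Longrightarrow> x \<in> carrier G \<Longrightarrow> y \<in> carrier G \<Longrightarrow> g \<otimes> x \<otimes> inv g = y \<longleftrightarrow> g \<otimes> x = y \<otimes> g"
  by (metis inv_solve_right m_closed)

lemma (in group) stabilizer_conj_action:
  "y \<in> carrier G \<Longrightarrow> stabilizer G (conj_action G) y = centralizer G y"
  unfolding stabilizer_def centralizer_def
  by (rule Collect_cong) (metis conj_eq_iff restrict_apply')

lemma (in group) card_class_mult_centralizer:
  "y \<in> carrier G \<Longrightarrow> card (orbit G (conj_action G) y) * card (centralizer G y) = order G"
  using group_action.orbit_stabilizer_theorem[OF action_by_conjugation, of y]
  by (simp add: stabilizer_conj_action)

lemma (in group) subgroup_centralizer:
  "y \<in> carrier G \<Longrightarrow> subgroup (centralizer G y) G"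
  using group_action.stabilizer_subgroup[OF action_by_conjugation, of y]
  by (simp add: stabilizer_conj_action)

text \<open>The subgroup generated by y is central in the centralizer C of y and has order coprime
  to \<open>s\<close>, so the solutions in C are counted in the smaller group C / <y>, where
  induction applies. The class size times |C / <y>| times o(y) is |G|, and dropping o(y) keeps the
  divisibility by \<open>s\<close>.\<close>

lemma (in group) dvd_class_mult_card_centralizer_roots:
  fixes s :: nat
  assumes fin: "finite (carrier G)"
    and IH: "\<And>(K :: 'a monoid) m. group K \<Longrightarrow> finite (carrier K) \<Longrightarrow> order K < order G \<Longrightarrow>
        m dvd order K \<Longrightarrow> m dvd card (pow_roots K m)"
    and y: "y \<in> carrier G" "ord y > 1" and cop: "coprime (ord y) s" and s: "s dvd order G"
  shows "s dvd card (orbit G (conj_action G) y) * card (pow_roots G s \<inter> centralizer G y)"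
proof -
  define C where "C = centralizer G y"
  define K where "K = G\<lparr>carrier := C\<rparr>"
  define N where "N = generate G {y}"
  have C: "subgroup C G" unfolding C_def by (rule subgroup_centralizer[OF y(1)])
  interpret K: group K unfolding K_def by (rule subgroup.subgroup_is_group[OF C is_group])
  have finK: "finite (carrier K)"
    using fin subgroup.subset[OF C] finite_subset by (auto simp: K_def)
  have N_eq: "N = {y [^] k |k. k \<in> (UNIV :: nat set)}"
    unfolding N_def by (rule generate_pow_on_finite_carrier[OF fin y(1)])
  have comm: "h \<otimes> g = g \<otimes> h" if hN: "h \<in> N" and "g \<in> C" for h g
  proof -
    have g: "g \<in> carrier G" "y \<otimes> g = g \<otimes> y" using that by (auto simp: C_def centralizer_def)
    obtain k :: nat where "h = y [^] k" using hN unfolding N_eq by blast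
    then show ?thesis using group_commutes_pow[OF g(2) y(1) g(1)] by simp
  qed
  have "y [^] k \<otimes> y = y \<otimes> y [^] k" for k :: nat
    using nat_pow_comm[OF y(1), of k 1] y by simp
  then have NC: "N \<subseteq> C" using y N_eq by (auto simp: C_def centralizer_def)
  have NG: "subgroup N G" unfolding N_def using y by (intro generate_is_subgroup) auto
  have NK: "subgroup N K" unfolding K_def by (rule subgroup_incl[OF NG C NC])
  have "N \<lhd> K"
  proof (rule K.normal_invI[OF NK])
    fix x h assume x: "x \<in> carrier K" and h: "h \<in> N"
    have "h \<in> carrier K" using NC h by (auto simp: K_def)
    moreover have "x \<otimes>\<^bsub>K\<^esub> h = h \<otimes>\<^bsub>K\<^esub> x" using comm[OF h] x by (simp add: K_def)
    ultimately have "x \<otimes>\<^bsub>K\<^esub> h \<otimes>\<^bsub>K\<^esub> inv\<^bsub>K\<^esub> x = h"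
      using K.conj_eq_iff[OF x] by blast
    then show "x \<otimes>\<^bsub>K\<^esub> h \<otimes>\<^bsub>K\<^esub> inv\<^bsub>K\<^esub> x \<in> N" using h by simp
  qed
  then interpret N: normal N K .
  define F where "F = flatten (K Mod N) (\<lambda>U. SOME g. g \<in> U)"
  have isoF: "(\<lambda>U. SOME g. g \<in> U) \<in> iso (K Mod N) F"
    unfolding F_def by (rule N.flatten_set_group_mod_iso)
  interpret F: group F unfolding F_def by (rule N.flatten_set_group_mod)
  have card_N: "card N = ord y" unfolding N_def using generate_pow_card[OF y(1)] by simp
  have commK: "h \<otimes>\<^bsub>K\<^esub> g = g \<otimes>\<^bsub>K\<^esub> h" if "h \<in> N" "g \<in> carrier K" for h g
    using comm[of h g] that by (simp add: K_def)
  have "card (pow_roots K s) = card (pow_roots (K Mod N) s)"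
    using K.card_pow_roots_central_quotient[OF \<open>N \<lhd> K\<close> commK, of s] cop card_N by simp
  also have "\<dots> = card (pow_roots F s)"
    by (rule card_pow_roots_iso[OF isoF N.factorgroup_is_group F.is_group])
  \<comment> \<open>\<open>s\<close> need not divide |F|. The solutions of x^s = 1 depend only on
    the gcd of \<open>s\<close> with the group order, and to that gcd the induction hypothesis
    applies.\<close>
  finally have roots: "card (pow_roots K s) = card (pow_roots F (gcd s (order F)))"
    by (simp add: F.pow_roots_gcd_order)
  have "order F = order (K Mod N)" using iso_same_card[OF is_isoI[OF isoF]] by (simp add: order_def)
  then have oF: "order F * ord y = card C"
    using N.order_FactGroup card_N by (simp add: order_def K_def)
  have oC: "card (orbit G (conj_action G) y) * card C = order G"
    unfolding C_def by (rule card_class_mult_centralizer[OF y(1)])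
  have pos: "order G > 0" using fin order_gt_0_iff_finite by simp
  then have "card C > 0" using oC by (metis gr0I mult_0_right)
  then have "order F > 0" using oF by (metis gr0I mult_0)
  then have finF: "finite (carrier F)" using F.order_gt_0_iff_finite by simp
  have "order F < order F * ord y" using y(2) \<open>order F > 0\<close> by simp
  also have "\<dots> \<le> order G"
    unfolding oF using dvd_imp_le[OF dvd_triv_right[of "card C"] pos[folded oC]] oC by simp
  finally have "gcd s (order F) dvd card (pow_roots K s)"
    using IH[OF F.is_group finF, of "gcd s (order F)"] roots by simp
  moreover have "s dvd card (orbit G (conj_action G) y) * gcd s (order F)"
  proof -
    have "s dvd card (orbit G (conj_action G) y) * order F * ord y"
      using s oC oF by (simp add: mult.assoc)
    then have "s dvd card (orbit G (conj_action G) y) * order F"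
      using cop by (simp add: coprime_commute coprime_dvd_mult_left_iff)
    then show ?thesis by (simp add: gcd_mult_distrib_nat)
  qed
  ultimately have "s dvd card (orbit G (conj_action G) y) * card (pow_roots K s)"
    by (meson dvd_trans mult_dvd_mono dvd_refl)
  then show ?thesis
    using pow_roots_carrier_update[of C G s] subgroup.subset[OF C] by (simp add: K_def C_def)
qed

section \<open>Conjugation and p-parts of elements\<close>

lemma (in group) ord_conj:
  assumes "g \<in> carrier G" "x \<in> carrier G"
  shows "ord (g \<otimes> x \<otimes> inv g) = ord x"
proof -
  have "(g \<otimes> x \<otimes> inv g) [^] n = g \<otimes> x [^] n \<otimes> inv g" for n :: nat
  proof (induction n)
    case (Suc n)
    have "g \<otimes> x [^] n \<otimes> inv g \<otimes> (g \<otimes> x \<otimes> inv g)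
        = g \<otimes> x [^] n \<otimes> (inv g \<otimes> g) \<otimes> x \<otimes> inv g"
      using assms by (simp only: m_assoc m_closed inv_closed nat_pow_closed)
    then show ?case using Suc assms by (simp add: m_assoc)
  qed (use assms in simp)
  then have "(g \<otimes> x \<otimes> inv g) [^] n = \<one> \<longleftrightarrow> x [^] n = \<one>" for n :: nat
    using assms by (simp add: conj_eq_iff)
  then show ?thesis using assms by (simp add: ord_unique pow_eq_id)
qed

text \<open>Makes the number of solutions that commute with y constant on the conjugacy class of
  y.\<close>

lemma (in group) bij_betw_centralizer_conj:
  assumes g: "g \<in> carrier G" and y: "y \<in> carrier G"
  shows "bij_betw (\<lambda>z. g \<otimes> z \<otimes> inv g) (pow_roots G s \<inter> centralizer G y)
    (pow_roots G s \<inter> centralizer G (g \<otimes> y \<otimes> inv g))"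
proof -
  have sub: "g \<otimes> z \<otimes> inv g \<in> pow_roots G s \<inter> centralizer G (g \<otimes> y \<otimes> inv g)"
    if g: "g \<in> carrier G" and y: "y \<in> carrier G" and z: "z \<in> pow_roots G s \<inter> centralizer G y" for g y z
  proof -
    have zc: "z \<in> carrier G" "z \<otimes> y = y \<otimes> z" using z by (auto simp: centralizer_def)
    have hom: "g \<otimes> a \<otimes> inv g \<otimes> (g \<otimes> b \<otimes> inv g) = g \<otimes> (a \<otimes> b) \<otimes> inv g"
      if "a \<in> carrier G" "b \<in> carrier G" for a b
    proof -
      have "g \<otimes> a \<otimes> inv g \<otimes> (g \<otimes> b \<otimes> inv g) = g \<otimes> a \<otimes> (inv g \<otimes> g) \<otimes> b \<otimes> inv g"
        using that g by (simp only: m_assoc m_closed inv_closed)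
      then show ?thesis using that g by (simp add: m_assoc)
    qed
    show ?thesis using z zc g y hom[OF zc(1) y] hom[OF y zc(1)]
      by (auto simp: mem_pow_roots_iff ord_conj centralizer_def)
  qed
  have cancel: "inv g \<otimes> (g \<otimes> a \<otimes> inv g) \<otimes> inv (inv g) = a" if "a \<in> carrier G" for a
    using that g by (simp add: conj_eq_iff m_assoc) (simp flip: m_assoc)
  have cancel': "g \<otimes> (inv g \<otimes> a \<otimes> inv (inv g)) \<otimes> inv g = a" if "a \<in> carrier G" for a
    using that g by (simp add: conj_eq_iff m_assoc) (simp flip: m_assoc)
  show ?thesis
  proof (rule bij_betw_byWitness[where f' = "\<lambda>z. inv g \<otimes> z \<otimes> inv (inv g)"])
    show "(\<lambda>z. inv g \<otimes> z \<otimes> inv (inv g)) ` (pow_roots G s \<inter> centralizer G (g \<otimes> y \<otimes> inv g))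
       \<subseteq> pow_roots G s \<inter> centralizer G y"
      using sub[of "inv g" "g \<otimes> y \<otimes> inv g"] cancel[OF y] g y by auto
  qed (use cancel cancel' sub[OF g y] in \<open>auto simp: pow_roots_def\<close>)
qed

text \<open>Write d = u p^j with p not dividing u. Then u divides \<open>s\<close>, so only an
  exponent j > k can keep d from dividing s p^k.\<close>

lemma prime_power_dvd_of_not_dvd:
  fixes d :: nat
  assumes "Factorial_Ring.prime p" "s > 0" "d dvd s * p ^ Suc k" "\<not> d dvd s * p ^ k"
  shows "p ^ Suc k dvd d"
proof -
  have d0: "d > 0" using assms by (intro Nat.gr0I) (auto simp: prime_gt_0_nat)
  obtain u j where u: "\<not> p dvd u" "d = u * p ^ j"
    using prime_power_canonical[OF assms(1) d0] by blast
  have "coprime u (p ^ Suc k)" using u(1) assms(1) prime_imp_coprime by (metis coprime_commute coprime_power_right_iff)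
  moreover have "u dvd s * p ^ Suc k" using assms(3) u(2) dvd_mult_left by blast
  ultimately have "u dvd s" by (simp add: coprime_dvd_mult_left_iff)
  have "\<not> j \<le> k"
  proof
    assume "j \<le> k"
    then have "u * p ^ j dvd s * p ^ k" using \<open>u dvd s\<close> by (intro mult_dvd_mono le_imp_power_dvd)
    then show False using u assms by simp
  qed
  then show ?thesis using u(2) by (metis dvd_mult le_imp_power_dvd not_less_eq_eq)
qed

text \<open>The orders of the elements in the difference are divisible by p^(k+1). Hence each of
  them is uniquely a commuting product y z with o(y) = p^(k+1) and z^s = 1, both factors being
  powers of it; the sum counts these pairs by y.\<close>

lemma (in group) card_split_coprime_part:
  assumes fin: "finite (carrier G)" and p: "Factorial_Ring.prime p" and s: "\<not> p dvd s"
  shows "card (pow_roots G (s * p ^ Suc k) - pow_roots G (s * p ^ k))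
    = (\<Sum>y | y \<in> carrier G \<and> ord y = p ^ Suc k. card (pow_roots G s \<inter> centralizer G y))"
proof -
  define S where "S = pow_roots G (s * p ^ Suc k) - pow_roots G (s * p ^ k)"
  define Y where "Y = {y \<in> carrier G. ord y = p ^ Suc k}"
  define q where "q = p ^ Suc k"
  have s0: "s > 0" using s by (intro Nat.gr0I) auto
  have cop: "coprime q s" unfolding q_def using s p prime_imp_coprime by (metis coprime_power_left_iff)
  obtain c d where cd: "[c = 1] (mod q)" "s dvd c" "[d = 1] (mod s)" "q dvd d"
      "[c + d = 1] (mod q * s)"
    using coprime_exponents[OF cop] by metis
  have "bij_betw (\<lambda>(y, z). y \<otimes> z) (SIGMA y:Y. pow_roots G s \<inter> centralizer G y) S"
  proof (rule bij_betw_byWitness[where f' = "\<lambda>x. (x [^] c, x [^] d)"])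
    have *: "(y \<otimes> z) [^] c = y" "(y \<otimes> z) [^] d = z"
      if "y \<in> Y" "z \<in> pow_roots G s \<inter> centralizer G y" for y z
    proof -
      have yz: "y \<in> carrier G" "z \<in> carrier G" "y \<otimes> z = z \<otimes> y" "y [^] q = \<one>" "z [^] s = \<one>"
        using that by (auto simp: Y_def pow_roots_def centralizer_def pow_eq_id q_def)
      have "y [^] c = y [^] (1::nat)" "z [^] d = z [^] (1::nat)"
        by (rule pow_cong[OF _ _ cd(1)] pow_cong[OF _ _ cd(3)]; use yz in simp)+
      moreover have "z [^] c = \<one>" "y [^] d = \<one>"
        using yz cd by (meson pow_eq_id dvd_trans)+
      ultimately show "(y \<otimes> z) [^] c = y" "(y \<otimes> z) [^] d = z"
        using yz by (simp_all add: pow_mult_distrib)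
    qed
    show "\<forall>a\<in>SIGMA y:Y. pow_roots G s \<inter> centralizer G y.
        (\<lambda>x. (x [^] c, x [^] d)) (case a of (y, z) \<Rightarrow> y \<otimes> z) = a"
      using * by auto
    have S: "x \<in> carrier G \<and> x [^] (q * s) = \<one> \<and> q dvd ord x" if "x \<in> S" for x
      using that prime_power_dvd_of_not_dvd[OF p s0, of "ord x" k]
      by (auto simp: S_def mem_pow_roots_iff q_def pow_eq_id mult.commute)
    show "\<forall>x\<in>S. (case (x [^] c, x [^] d) of (y, z) \<Rightarrow> y \<otimes> z) = x"
    proof
      fix x assume x: "x \<in> S"
      have "x [^] (c + d) = x [^] (1::nat)" using S[OF x] by (intro pow_cong[OF _ _ cd(5)]) auto
      then show "(case (x [^] c, x [^] d) of (y, z) \<Rightarrow> y \<otimes> z) = x" using S[OF x] by (simp add: nat_pow_mult)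
    qed
    show "(\<lambda>(y, z). y \<otimes> z) ` (SIGMA y:Y. pow_roots G s \<inter> centralizer G y) \<subseteq> S"
    proof clarify
      fix y z assume y: "y \<in> Y" and z: "z \<in> pow_roots G s" "z \<in> centralizer G y"
      have yz: "y \<in> carrier G" "z \<in> carrier G" "y \<otimes> z = z \<otimes> y" "ord y = q" "ord z dvd s"
        using y z by (auto simp: Y_def mem_pow_roots_iff centralizer_def q_def)
      have "ord (y \<otimes> z) dvd q * s"
        using ord_mul_divides[OF yz(3,1,2)] yz by (meson dvd_trans mult_dvd_mono dvd_refl)
      \<comment> \<open>Otherwise the order \<open>q\<close> of y = (y z)^c would divide s p^k,
        hence p^k, since \<open>q\<close> is coprime to \<open>s\<close>.\<close>
      moreover have "\<not> ord (y \<otimes> z) dvd s * p ^ k"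
      proof
        assume "ord (y \<otimes> z) dvd s * p ^ k"
        then have "((y \<otimes> z) [^] c) [^] (s * p ^ k) = \<one>"
          using yz by (metis m_closed mult.commute nat_pow_one nat_pow_pow pow_eq_id)
        moreover have "(y \<otimes> z) [^] c = y" using *(1)[OF y] z by blast
        ultimately have "q dvd s * p ^ k" using pow_eq_id[OF yz(1)] yz(4) by simp
        then have "q dvd p ^ k" using cop by (simp add: coprime_dvd_mult_right_iff)
        then show False using p unfolding q_def by (metis dvd_power_iff_le le_imp_less_Suc le_refl not_less prime_ge_2_nat)
      qed
      ultimately show "y \<otimes> z \<in> S" using yz by (simp add: S_def mem_pow_roots_iff q_def mult.commute)
    qed
    show "(\<lambda>x. (x [^] c, x [^] d)) ` S \<subseteq> (SIGMA y:Y. pow_roots G s \<inter> centralizer G y)"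
    proof clarify
      fix x assume x: "x \<in> S"
      have xc: "x \<in> carrier G" using S[OF x] by simp
      have "ord x dvd d * s" using S[OF x] cd(4) by (metis dvd_trans mult_dvd_mono dvd_refl pow_eq_id)
      then have z: "x [^] d \<in> pow_roots G s" using xc by (simp add: mem_pow_roots_iff nat_pow_pow flip: pow_eq_id)
      \<comment> \<open>Raising to the power \<open>c\<close> does not shrink the p-part of the
        order: \<open>q\<close> divides o(x), which divides c o(x^c), and \<open>c\<close> is prime
        to \<open>q\<close>.\<close>
      have "coprime c q" using cd(1) by (metis cong_imp_coprime cong_sym coprime_1_left)
      have "ord x dvd c * q" using S[OF x] cd(2) by (metis dvd_trans mult_dvd_mono dvd_refl pow_eq_id mult.commute)
      then have "ord (x [^] c) dvd q" using xc by (simp add: nat_pow_pow flip: pow_eq_id)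
      moreover have "q dvd ord (x [^] c)"
      proof -
        have "ord x dvd c * ord (x [^] c)" using xc by (simp add: nat_pow_pow flip: pow_eq_id) (simp flip: nat_pow_pow)
        then have "q dvd c * ord (x [^] c)" using S[OF x] dvd_trans by blast
        then show ?thesis using \<open>coprime c q\<close> by (simp add: coprime_dvd_mult_right_iff coprime_commute)
      qed
      ultimately have "ord (x [^] c) = q" by (rule dvd_antisym)
      then have "x [^] c \<in> Y" using xc by (simp add: Y_def q_def)
      moreover have "x [^] d \<in> centralizer G (x [^] c)"
        using xc nat_pow_comm by (simp add: centralizer_def)
      ultimately show "x [^] c \<in> Y \<and> x [^] d \<in> pow_roots G s \<inter> centralizer G (x [^] c)" using z by simp
    qed
  qed
  then have "card S = card (SIGMA y:Y. pow_roots G s \<inter> centralizer G y)"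
    by (simp add: bij_betw_same_card)
  also have "\<dots> = (\<Sum>y\<in>Y. card (pow_roots G s \<inter> centralizer G y))"
    using fin by (intro card_SigmaI) (auto simp: Y_def finite_pow_roots)
  finally show ?thesis by (simp add: S_def Y_def)
qed

section \<open>The induction for Frobenius' theorem\<close>

lemma (in group_action) dvd_sum_of_dvd_orbits:
  fixes f :: "'c \<Rightarrow> nat"
  assumes "finite Y" "Y \<subseteq> E" and closed: "\<And>y. y \<in> Y \<Longrightarrow> orbit G \<phi> y \<subseteq> Y"
    and dvd: "\<And>y. y \<in> Y \<Longrightarrow> q dvd sum f (orbit G \<phi> y)"
  shows "q dvd sum f Y"
proof (rule dvd_sum_fibers[where f = "orbit G \<phi>", OF assms(1)])
  fix y assume y: "y \<in> Y"
  have "{z. z \<in> Y \<and> orbit G \<phi> z = orbit G \<phi> y} = orbit G \<phi> y"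
  proof (intro equalityI subsetI)
    fix z assume "z \<in> {z. z \<in> Y \<and> orbit G \<phi> z = orbit G \<phi> y}"
    then show "z \<in> orbit G \<phi> y" using orbit_refl[of z] assms(2) by auto
  next
    fix z assume z: "z \<in> orbit G \<phi> y"
    then have zY: "z \<in> Y" using closed[OF y] by blast
    have "orbit G \<phi> z \<in> orbits G E \<phi>" "orbit G \<phi> y \<in> orbits G E \<phi>"
      using y zY assms(2) by (auto simp: orbits_def)
    then have "orbit G \<phi> z = orbit G \<phi> y"
      using disjoint_union[of "orbit G \<phi> z" "orbit G \<phi> y"] z orbit_refl[of z] zY assms(2) by auto
    then show "z \<in> {z. z \<in> Y \<and> orbit G \<phi> z = orbit G \<phi> y}" using zY by simp
  qed
  then show "q dvd (\<Sum>z | z \<in> Y \<and> orbit G \<phi> z = orbit G \<phi> y. f z)" using dvd[OF y] by simp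
qed

text \<open>The inner induction descends from n = |G|, where every element is a solution. For
  smaller n it provides that n p divides the count for n p, so it suffices that n = s p^k divides
  the number of elements gained in passing from n to n p.\<close>

lemma (in group) frobenius_step:
  assumes fin: "finite (carrier G)"
    and IH: "\<And>(K :: 'a monoid) m. group K \<Longrightarrow> finite (carrier K) \<Longrightarrow> order K < order G \<Longrightarrow>
        m dvd order K \<Longrightarrow> m dvd card (pow_roots K m)"
    and n: "n dvd order G"
  shows "n dvd card (pow_roots G n)"
  using n
proof (induction "order G div n" arbitrary: n rule: less_induct)
  case (less n)
  have pos: "order G > 0" using fin order_gt_0_iff_finite by simp
  have n0: "n > 0" using less.prems pos by (intro Nat.gr0I) auto
  show ?case
  proof (cases "order G div n = 1")
    case True
    then have n: "n = order G" using dvd_mult_div_cancel[OF less.prems] by simp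
    then have "pow_roots G n = carrier G"
      using ord_dvd_group_order by (auto simp: mem_pow_roots_iff)
    then show ?thesis using n by (simp add: order_def)
  next
    case False
    then obtain p where p: "Factorial_Ring.prime p" "p dvd order G div n"
      using prime_factor_nat by blast
    then have np: "n * p dvd order G"
      using mult_dvd_mono[OF dvd_refl[of n] p(2)] dvd_mult_div_cancel[OF less.prems] by simp
    obtain s k where sk: "\<not> p dvd s" "n = s * p ^ k"
      using prime_power_canonical[OF p(1) n0] by blast
    have s0: "s > 0" using sk n0 by (intro Nat.gr0I) auto
    have npe: "n * p = s * p ^ Suc k" using sk by simp
    have "order G div n > 0" using less.prems pos by (auto elim: dvdE)
    then have "order G div (n * p) < order G div n"
      using prime_gt_1_nat[OF p(1)] by (simp add: div_mult2_eq)
    then have "n * p dvd card (pow_roots G (n * p))" using np by (rule less.hyps)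
    then have dvd1: "n dvd card (pow_roots G (n * p))" by (rule dvd_mult_left)
    define S where "S = pow_roots G (n * p) - pow_roots G n"
    have sub: "pow_roots G n \<subseteq> pow_roots G (n * p)" by (auto simp: mem_pow_roots_iff)
    have card_S: "card (pow_roots G (n * p)) = card (pow_roots G n) + card S"
      unfolding S_def using card_Diff_subset[OF finite_pow_roots[OF fin] sub]
        card_mono[OF finite_pow_roots[OF fin] sub] by simp
    \<comment> \<open>The order of each element of \<open>S\<close> is a multiple of p^(k+1), and
      phi(p^(k+1)) = p^k (p - 1).\<close>
    have "p ^ k dvd card S"
    proof (rule dvd_card_of_dvd_totient[OF fin])
      fix x assume x: "x \<in> S"
      then have "p ^ Suc k dvd ord x"
        using prime_power_dvd_of_not_dvd[OF p(1) s0, of "ord x" k] sk(2)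
        unfolding S_def npe by (simp only: mem_pow_roots_iff Diff_iff) blast
      then have "totient (p ^ Suc k) dvd totient (ord x)" by (rule totient_dvd)
      then show "p ^ k dvd totient (ord x)"
        unfolding totient_prime_power_Suc[OF p(1)] by (rule dvd_mult_left)
    qed (auto simp: S_def mem_pow_roots_iff)
    \<comment> \<open>\<open>S\<close> is counted by p-parts y, and the number of partners of y is
      constant on conjugacy classes, so divisibility by \<open>s\<close> can be checked on one class
      at a time.\<close>
    moreover have "s dvd card S"
    proof -
      define Y where "Y = {y \<in> carrier G. ord y = p ^ Suc k}"
      define f where "f = (\<lambda>y. card (pow_roots G s \<inter> centralizer G y))"
      interpret A: group_action G "carrier G" "conj_action G" by (rule action_by_conjugation)
      have "s dvd sum f Y"
      proof (rule A.dvd_sum_of_dvd_orbits)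
        show "finite Y" "Y \<subseteq> carrier G" using fin by (auto simp: Y_def)
        fix y assume y: "y \<in> Y"
        then have yc: "y \<in> carrier G" "ord y = p ^ Suc k" by (auto simp: Y_def)
        let ?O = "orbit G (conj_action G)"
        have O: "?O y = {g \<otimes> y \<otimes> inv g |g. g \<in> carrier G}" using yc by (auto simp: orbit_def)
        show "?O y \<subseteq> Y" using yc by (auto simp: O Y_def ord_conj)
        have "f z = f y" if "z \<in> ?O y" for z
          using that bij_betw_same_card[OF bij_betw_centralizer_conj[OF _ yc(1)]]
          by (auto simp: O f_def)
        then have "sum f (?O y) = card (?O y) * f y" by simp
        moreover have "ord y > 1"
          unfolding yc(2) by (rule one_less_power[OF prime_gt_1_nat[OF p(1)]]) simp
        moreover have "coprime (ord y) s" unfolding yc(2)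
          using sk(1) p(1) prime_imp_coprime by (metis coprime_power_left_iff)
        moreover have "s dvd order G" using less.prems unfolding sk(2) by (rule dvd_mult_left)
        ultimately show "s dvd sum f (?O y)"
          using dvd_class_mult_card_centralizer_roots[OF fin IH yc(1)] by (simp add: f_def)
      qed
      then show ?thesis
        using card_split_coprime_part[OF fin p(1) sk(1), of k, folded npe sk(2)]
        unfolding S_def f_def Y_def by metis
    qed
    moreover have "coprime (p ^ k) s"
      using sk(1) p(1) prime_imp_coprime by (metis coprime_power_left_iff)
    ultimately have "p ^ k * s dvd card S" by (rule divides_mult)
    then have "n dvd card S" using sk(2) by (simp add: mult.commute)
    then show ?thesis using dvd1 card_S by (simp add: dvd_add_left_iff)
  qed
qed

text \<open>The induction hypothesis speaks about one element type, so the quotient used in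
  \<open>dvd_class_mult_card_centralizer_roots\<close> is moved to coset representatives in \<open>'a\<close>.\<close>

lemma frobenius_monoid:
  fixes G :: "'a monoid"
  assumes "group G" "finite (carrier G)" "m dvd order G"
  shows "m dvd card (pow_roots G m)"
  using assms
proof (induction "order G" arbitrary: G m rule: less_induct)
  case less
  show ?case
  proof (rule group.frobenius_step[OF less.prems(1,2) _ less.prems(3)])
    fix K :: "'a monoid" and l
    assume "group K" "finite (carrier K)" "order K < order G" "l dvd order K"
    then show "l dvd card (pow_roots K l)" by (intro less.hyps)
  qed
qed

theorem (in group) frobenius:
  assumes "finite (carrier G)" "m dvd order G"
  shows "m dvd card (pow_roots G m)"
  by (rule frobenius_step[OF assms(1) _ assms(2)]) (rule frobenius_monoid)

subsection \<open>Solution sets that are subgroups of the expected order\<close>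

text \<open>In a finite group such a solution set is normal and is the only subgroup of order
  \<open>m\<close>. In this form equality of counts can be multiplied over coprime values of
  \<open>m\<close>.\<close>

definition roots_subgroup :: "('a, 'b) monoid_scheme \<Rightarrow> nat \<Rightarrow> bool" where
  "roots_subgroup G m \<longleftrightarrow> subgroup (pow_roots G m) G \<and> card (pow_roots G m) = m"

lemma (in group) normal_pow_roots:
  "subgroup (pow_roots G m) G \<Longrightarrow> pow_roots G m \<lhd> G"
  by (rule normal_invI) (auto simp: mem_pow_roots_iff ord_conj)

lemma (in group) subgroup_pow_card:
  assumes "subgroup H G" "x \<in> H"
  shows "x [^] card H = \<one>"
  using group.pow_order_eq_1[OF subgroup.subgroup_is_group[OF assms(1) is_group], of x] assms(2)
  by (simp add: order_def nat_pow_def)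

lemma (in group) subgroup_subset_pow_roots:
  assumes "subgroup H G" "card H dvd m"
  shows "H \<subseteq> pow_roots G m"
proof
  fix x assume x: "x \<in> H"
  then have "x \<in> carrier G" using subgroup.subset[OF assms(1)] by blast
  moreover have "ord x dvd card H"
    using subgroup_pow_card[OF assms(1) x] pow_eq_id[OF \<open>x \<in> carrier G\<close>] by simp
  ultimately show "x \<in> pow_roots G m" using assms(2) by (simp add: mem_pow_roots_iff dvd_trans[of "ord x"])
qed

lemma (in group) subgroup_eq_pow_roots:
  assumes "finite (carrier G)" "subgroup H G" "card H = m" "card (pow_roots G m) = m"
  shows "H = pow_roots G m"
  using card_subset_eq[OF finite_pow_roots[OF assms(1)] subgroup_subset_pow_roots[OF assms(2)]] assms
  by simp

lemma (in group) coprime_roots_eq_one: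
  assumes "x \<in> pow_roots G a" "x \<in> pow_roots G b" "coprime a b"
  shows "x = \<one>"
  using assms coprime_common_divisor_nat[OF assms(3), of "ord x"] ord_eq_1[of x]
  by (simp add: mem_pow_roots_iff)

lemma (in group) coprime_subgroups_Int:
  assumes "subgroup A G" "subgroup B G" "coprime (card A) (card B)"
  shows "A \<inter> B \<subseteq> {\<one>}"
  using subgroup_subset_pow_roots[OF assms(1) dvd_refl] subgroup_subset_pow_roots[OF assms(2) dvd_refl]
    coprime_roots_eq_one[OF _ _ assms(3)] by auto

text \<open>Coprime orders force a trivial intersection, so the products a b are pairwise
  distinct.\<close>

lemma (in group) card_set_mult_coprime:
  assumes A: "subgroup A G" and B: "subgroup B G" and cop: "coprime (card A) (card B)"
  shows "card (A <#> B) = card A * card B"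
proof -
  interpret D: group_disjoint_sum G A B
    using A B is_group by (simp add: group_disjoint_sum_def)
  have "A <#> B = (\<lambda>(a, b). a \<otimes> b) ` (A \<times> B)" by (auto simp: set_mult_def)
  moreover have "inj_on (\<lambda>(a, b). a \<otimes> b) (A \<times> B)"
    using coprime_subgroups_Int[OF A B cop] unfolding D.cancel by (auto simp: inj_on_def)
  ultimately show ?thesis by (simp add: card_image card_cartesian_product)
qed

lemma (in group) coprime_roots_decompose:
  assumes "coprime a b" "x \<in> pow_roots G (a * b)"
  obtains y z where "y \<in> pow_roots G a" "z \<in> pow_roots G b" "x = y \<otimes> z"
proof -
  have x: "x \<in> carrier G" "x [^] (a * b) = \<one>" "ord x dvd a * b"
    using assms(2) by (auto simp: pow_roots_def pow_eq_id)
  obtain c d where cd: "b dvd c" "a dvd d" "[c + d = 1] (mod a * b)"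
    using coprime_exponents[OF assms(1)] by metis
  have "ord x dvd c * a" "ord x dvd d * b"
    using x(3) cd mult_dvd_mono[of b c a a] mult_dvd_mono[of a d b b]
    by (auto simp: mult.commute intro: dvd_trans)
  then have "x [^] c \<in> pow_roots G a" "x [^] d \<in> pow_roots G b"
    using x(1) by (auto simp: pow_roots_def nat_pow_pow pow_eq_id)
  moreover have "x = x [^] c \<otimes> x [^] d"
    using pow_cong[OF x(1,2) cd(3)] x(1) by (simp add: nat_pow_mult)
  ultimately show thesis by (rule that)
qed

text \<open>The first solution set is normal, so the product of the two is a subgroup, of order a b;
  by Lagrange its elements solve x^(a b) = 1. Conversely each such solution splits into its two
  coprime parts.\<close>

lemma (in group) roots_subgroup_coprime_mult:
  assumes a: "roots_subgroup G a" and b: "roots_subgroup G b" and cop: "coprime a b"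
  shows "roots_subgroup G (a * b)"
proof -
  let ?A = "pow_roots G a" and ?B = "pow_roots G b"
  have A: "?A \<lhd> G" "card ?A = a" and B: "subgroup ?B G" "card ?B = b"
    using a b normal_pow_roots by (auto simp: roots_subgroup_def)
  have AB: "subgroup (?A <#> ?B) G" by (rule mult_norm_subgroup[OF A(1) B(1)])
  have card: "card (?A <#> ?B) = a * b"
    using card_set_mult_coprime[OF normal_imp_subgroup[OF A(1)] B(1)] A B cop by simp
  have "pow_roots G (a * b) = ?A <#> ?B"
  proof (intro equalityI subsetI)
    fix x assume "x \<in> pow_roots G (a * b)"
    then show "x \<in> ?A <#> ?B"
      by (rule coprime_roots_decompose[OF cop]) (auto simp: set_mult_def)
  next
    fix x assume "x \<in> ?A <#> ?B"
    then show "x \<in> pow_roots G (a * b)" using subgroup_subset_pow_roots[OF AB, of "a * b"] card by auto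
  qed
  then show ?thesis using AB card by (simp add: roots_subgroup_def)
qed

text \<open>Sylow's theorem provides a subgroup of order p^k for every power of p dividing |G|, not
  only the largest. It lies in the solution set and has the same size.\<close>

lemma (in group) roots_subgroup_prime_power:
  assumes "finite (carrier G)" "Factorial_Ring.prime p" "p ^ k dvd order G"
    "card (pow_roots G (p ^ k)) = p ^ k"
  shows "roots_subgroup G (p ^ k)"
proof -
  obtain m where "order G = p ^ k * m" using assms(3) by (auto elim: dvdE)
  then obtain H where "subgroup H G" "card H = p ^ k"
    using sylow_thm[OF assms(2) is_group _ assms(1)] by blast
  then show ?thesis using subgroup_eq_pow_roots[OF assms(1) _ _ assms(4), of H] assms(4)
    by (simp add: roots_subgroup_def)
qed

lemma multiplicity_coprime_mult:
  fixes a b p :: nat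
  assumes "coprime a b" "Factorial_Ring.prime p" "p dvd a" "a > 0" "b > 0"
  shows "multiplicity p (a * b) = multiplicity p a"
proof -
  have "\<not> p dvd b" using assms(1-3) not_prime_unit coprime_common_divisor by blast
  then show ?thesis
    using assms by (simp add: prime_elem_multiplicity_mult_distrib not_dvd_imp_multiplicity_0)
qed

text \<open>Split off one full prime power at a time; the cofactor keeps its exponents at the
  remaining primes.\<close>

lemma (in group) roots_subgroup_of_prime_powers:
  assumes "m > 0"
    and "\<And>p. Factorial_Ring.prime p \<Longrightarrow> p dvd m \<Longrightarrow> roots_subgroup G (p ^ multiplicity p m)"
  shows "roots_subgroup G m"
  using assms
proof (induction m rule: less_induct)
  case (less m)
  show ?case
  proof (cases "m = 1")
    case True
    then have "pow_roots G m = {\<one>}" by (auto simp: pow_roots_def)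
    then show ?thesis using True triv_subgroup by (simp add: roots_subgroup_def)
  next
    case False
    then obtain p where p: "Factorial_Ring.prime p" "p dvd m" using prime_factor_nat by blast
    define q where "q = p ^ multiplicity p m"
    obtain b where b: "m = q * b" "\<not> p dvd b"
      unfolding q_def
    proof (rule multiplicity_decompose'[of m p])
      show "m \<noteq> 0" "\<not> is_unit p" using less.prems(1) p(1) by auto
    qed
    have b0: "b > 0" using b less.prems(1) by (intro Nat.gr0I) auto
    have q0: "q > 0" using b less.prems(1) by (intro Nat.gr0I) auto
    have "multiplicity p m > 0" using p less.prems(1) by (simp add: prime_multiplicity_gt_zero_iff)
    then have "q > 1" unfolding q_def using one_less_power[OF prime_gt_1_nat[OF p(1)]] by blast
    then have "b < m" using b b0 by simp
    have cop: "coprime q b"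
      unfolding q_def using prime_imp_coprime[OF p(1) b(2)] by simp
    have "roots_subgroup G b"
    proof (rule less.IH[OF \<open>b < m\<close> b0])
      fix r :: nat assume r: "Factorial_Ring.prime r" "r dvd b"
      have "multiplicity r m = multiplicity r b"
        using multiplicity_coprime_mult[of b q r] cop r b0 q0 b(1)
        by (simp add: mult.commute coprime_commute)
      then show "roots_subgroup G (r ^ multiplicity r b)"
        using less.prems(2)[OF r(1)] r(2) b(1) by simp
    qed
    moreover have "roots_subgroup G q" unfolding q_def by (rule less.prems(2)[OF p])
    ultimately show ?thesis using roots_subgroup_coprime_mult cop b(1) by simp
  qed
qed

text \<open>As a and b are coprime, the primes of a have the same exponents in a as in a b.\<close>

lemma (in group) roots_subgroup_hall_divisor:
  assumes "a > 0" "b > 0" "coprime a b"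
    and "\<And>p. Factorial_Ring.prime p \<Longrightarrow> p dvd a * b \<Longrightarrow>
      roots_subgroup G (p ^ multiplicity p (a * b))"
  shows "roots_subgroup G a"
  using assms(1)
proof (rule roots_subgroup_of_prime_powers)
  fix p :: nat assume p: "Factorial_Ring.prime p" "p dvd a"
  show "roots_subgroup G (p ^ multiplicity p a)"
    using assms(4)[OF p(1)] multiplicity_coprime_mult[OF assms(3) p assms(1,2)] p(2) by simp
qed

text \<open>Class equation: with a trivial center every class other than that of the identity would
  have size p^i with i > 0, so p would divide |G| - 1 as well as |G|.\<close>

lemma (in group) prime_power_group_center:
  assumes p: "Factorial_Ring.prime p" and ord: "order G = p ^ Suc k"
  shows "\<exists>z\<in>carrier G. z \<noteq> \<one> \<and> (\<forall>g\<in>carrier G. z \<otimes> g = g \<otimes> z)"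
proof (rule ccontr)
  assume nc: "\<not> ?thesis"
  have pos: "order G > 0" using ord prime_gt_0_nat[OF p] by simp
  then have fin: "finite (carrier G)" using order_gt_0_iff_finite by simp
  interpret A: group_action G "carrier G" "conj_action G" by (rule action_by_conjugation)
  let ?O = "orbit G (conj_action G)"
  have "p dvd (\<Sum>y\<in>carrier G - {\<one>}. 1)"
  proof (rule A.dvd_sum_of_dvd_orbits)
    fix y assume "y \<in> carrier G - {\<one>}"
    then have y: "y \<in> carrier G" "y \<noteq> \<one>" by auto
    show "?O y \<subseteq> carrier G - {\<one>}"
    proof
      fix x assume "x \<in> ?O y"
      then obtain g where g: "g \<in> carrier G" "x = g \<otimes> y \<otimes> inv g" using y by (auto simp: orbit_def)
      then show "x \<in> carrier G - {\<one>}" using y ord_conj[OF g(1) y(1)] ord_eq_1[of y] by auto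
    qed
    obtain g where "g \<in> carrier G" "y \<otimes> g \<noteq> g \<otimes> y" using nc y by blast
    then have "g \<notin> centralizer G y" "g \<in> carrier G" by (auto simp: centralizer_def)
    then have "centralizer G y \<noteq> carrier G" by blast
    moreover have "centralizer G y \<subseteq> carrier G" by (auto simp: centralizer_def)
    ultimately have "card (centralizer G y) \<noteq> order G"
      unfolding order_def using card_subset_eq[OF fin] by blast
    then have "card (?O y) \<noteq> 1" using card_class_mult_centralizer[OF y(1)] by auto
    moreover have "card (?O y) dvd p ^ Suc k"
      using dvd_triv_left[of "card (?O y)" "card (centralizer G y)"]
      unfolding card_class_mult_centralizer[OF y(1)] ord .
    then obtain i where i: "card (?O y) = p ^ i" using divides_primepow_nat[OF p] by blast
    ultimately have "i > 0" by (intro Nat.gr0I) auto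
    then have "p dvd card (?O y)" unfolding i by (simp add: dvd_power)
    then show "p dvd (\<Sum>z\<in>?O y. 1)" by simp
  qed (use fin in auto)
  then have "p dvd order G - 1" using fin by (simp add: order_def card_Diff_singleton)
  moreover have "p dvd order G" using ord by simp
  ultimately have "p dvd 1" by (rule dvd_diffD1) (use pos in simp)
  then show False using p by (simp add: prime_nat_iff)
qed

subsection \<open>Upper central series\<close>

text \<open>Defined by commutators, in the convention of \<open>lower_central\<close>, rather than
  by iterated centers of quotients: all terms are subsets of one group and the two series can be
  compared directly.\<close>

fun upper_central :: "('a, 'b) monoid_scheme \<Rightarrow> nat \<Rightarrow> 'a set" where
  "upper_central G 0 = {\<one>\<^bsub>G\<^esub>}"
| "upper_central G (Suc i) = {z \<in> carrier G. \<forall>g\<in>carrier G.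
     z \<otimes>\<^bsub>G\<^esub> g \<otimes>\<^bsub>G\<^esub> inv\<^bsub>G\<^esub> z \<otimes>\<^bsub>G\<^esub> inv\<^bsub>G\<^esub> g \<in> upper_central G i}"

definition center :: "('a, 'b) monoid_scheme \<Rightarrow> 'a set" where
  "center G = {z \<in> carrier G. \<forall>g\<in>carrier G. z \<otimes>\<^bsub>G\<^esub> g = g \<otimes>\<^bsub>G\<^esub> z}"



lemma (in group) normal_center: "center G \<lhd> G"
proof (rule normal_invI)
  have "center G = \<Inter>(insert (carrier G) (centralizer G ` carrier G))"
    by (auto simp: center_def centralizer_def)
  then show "subgroup (center G) G"
    using subgroups_Inter[of "insert (carrier G) (centralizer G ` carrier G)"]
      subgroup_self subgroup_centralizer by auto
  fix x h assume x: "x \<in> carrier G" and h: "h \<in> center G"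
  then have "x \<otimes> h \<otimes> inv x = h" by (simp add: conj_eq_iff center_def)
  then show "x \<otimes> h \<otimes> inv x \<in> center G" using h by simp
qed

lemma (in normal) commutator_mem_iff:
  assumes "z \<in> carrier G" "g \<in> carrier G"
  shows "z \<otimes> g \<otimes> inv z \<otimes> inv g \<in> H
    \<longleftrightarrow> (H #> z) \<otimes>\<^bsub>G Mod H\<^esub> (H #> g) = (H #> g) \<otimes>\<^bsub>G Mod H\<^esub> (H #> z)"
proof -
  have "z \<otimes> g \<otimes> inv z \<otimes> inv g = z \<otimes> g \<otimes> inv (g \<otimes> z)"
    using assms by (simp add: inv_mult_group m_assoc)
  then have "z \<otimes> g \<otimes> inv z \<otimes> inv g \<in> H \<longleftrightarrow> z \<otimes> g \<in> H #> (g \<otimes> z)"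
    using rcos_module[OF is_group, of "g \<otimes> z" "z \<otimes> g"] assms by simp
  also have "\<dots> \<longleftrightarrow> H #> (z \<otimes> g) = H #> (g \<otimes> z)"
    using repr_independence[of "z \<otimes> g" H "g \<otimes> z"] rcos_self[of "z \<otimes> g" H] is_subgroup assms
    by auto
  finally show ?thesis using assms by (simp add: rcos_sum)
qed

text \<open>Serves to prove that the terms are normal subgroups: each is the preimage of the center
  of a quotient, which is normal there.\<close>

lemma (in group) upper_central_Suc_eq:
  assumes "upper_central G i \<lhd> G"
  shows "upper_central G (Suc i) = \<Union>(center (G Mod upper_central G i))"
proof -
  interpret N: normal "upper_central G i" G by (rule assms)
  interpret Q: group "G Mod upper_central G i" by (rule N.factorgroup_is_group)
  have "\<Union>(center (G Mod upper_central G i))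
      = {x \<in> carrier G. upper_central G i #> x \<in> center (G Mod upper_central G i)}"
    using N.factgroup_subgroup_union_char normal_imp_subgroup[OF Q.normal_center] .
  then show ?thesis using N.commutator_mem_iff by (auto simp: center_def carrier_FactGroup)
qed

lemma (in group) normal_upper_central: "upper_central G i \<lhd> G"
proof (induction i)
  case 0
  show ?case by (simp add: one_is_normal)
next
  case (Suc i)
  interpret N: normal "upper_central G i" G by (rule Suc)
  interpret Q: group "G Mod upper_central G i" by (rule N.factorgroup_is_group)
  show ?case unfolding upper_central_Suc_eq[OF Suc]
    by (rule N.factgroup_subgroup_union_normal[OF Q.normal_center])
qed

lemma (in group) upper_central_mono: "upper_central G i \<subseteq> upper_central G (Suc i)"
proof
  interpret N: normal "upper_central G i" G by (rule normal_upper_central)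
  fix z assume z: "z \<in> upper_central G i"
  then have zc: "z \<in> carrier G" using N.subset by blast
  have "z \<otimes> g \<otimes> inv z \<otimes> inv g \<in> upper_central G i" if g: "g \<in> carrier G" for g
  proof -
    have "z \<otimes> (g \<otimes> inv z \<otimes> inv g) \<in> upper_central G i"
      using z N.inv_op_closed2[OF g N.m_inv_closed[OF z]] by (rule N.m_closed)
    then show ?thesis using zc g by (simp add: m_assoc)
  qed
  then show "z \<in> upper_central G (Suc i)" using zc by simp
qed

text \<open>Commutators with an element of one ascending term fall into the term before it, so by
  induction \<open>lower_central G j\<close> lies in \<open>upper_central G (c - j)\<close>.\<close>

lemma (in group) nilpotent_if_upper_central:
  assumes "upper_central G c = carrier G"
  shows "nilpotent_group G"
proof -
  have "lower_central G j \<subseteq> upper_central G (c - j)" if "j \<le> c" for j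
    using that
  proof (induction j)
    case 0
    then show ?case using assms by simp
  next
    case (Suc j)
    then have c: "c - j = Suc (c - Suc j)" by simp
    have "lower_central G j \<subseteq> upper_central G (Suc (c - Suc j))" using Suc c by simp
    then have "(\<Union>h \<in> lower_central G j. \<Union>g \<in> carrier G. {h \<otimes> g \<otimes> inv h \<otimes> inv g})
        \<subseteq> upper_central G (c - Suc j)"
      by auto
    then show ?case
      using generate_subgroup_incl[OF _ normal_imp_subgroup[OF normal_upper_central]] by simp
  qed
  from this[of c] have "lower_central G c \<subseteq> {\<one>}" by simp
  moreover have "\<one> \<in> lower_central G c" by (cases c) (auto intro: generate.one)
  ultimately show ?thesis using is_group by (auto simp: nilpotent_group_def)
qed

text \<open>If the ascending series never reached the whole group, it would increase strictly
  forever, and its i-th term would have at least i elements.\<close>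

lemma (in group) nilpotent_if_upper_central_grows:
  assumes fin: "finite (carrier G)"
    and grows: "\<And>i. upper_central G i \<noteq> carrier G \<Longrightarrow> upper_central G (Suc i) \<noteq> upper_central G i"
  shows "nilpotent_group G"
proof (rule ccontr)
  assume "\<not> ?thesis"
  then have ne: "upper_central G i \<noteq> carrier G" for i using nilpotent_if_upper_central by blast
  have sub: "upper_central G i \<subseteq> carrier G" for i
    using subgroup.subset[OF normal_imp_subgroup[OF normal_upper_central]] .
  have "i \<le> card (upper_central G i)" for i
  proof (induction i)
    case (Suc i)
    have "upper_central G i \<subset> upper_central G (Suc i)"
      using upper_central_mono[of i] grows[OF ne[of i]] by blast
    then have "card (upper_central G i) < card (upper_central G (Suc i))"
      by (rule psubset_card_mono[OF finite_subset[OF sub fin]])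
    then show ?case using Suc by simp
  qed simp
  from this[of "Suc (card (carrier G))"] show False
    using card_mono[OF fin sub[of "Suc (card (carrier G))"]] by simp
qed

text \<open>Both solution sets are normal, so the commutator of x and y lies in both, and only the
  identity does.\<close>

lemma (in group) coprime_roots_commute:
  assumes A: "subgroup (pow_roots G a) G" and B: "subgroup (pow_roots G b) G" and cop: "coprime a b"
    and x: "x \<in> pow_roots G a" and y: "y \<in> pow_roots G b"
  shows "x \<otimes> y = y \<otimes> x"
proof -
  interpret A: normal "pow_roots G a" G by (rule normal_pow_roots[OF A])
  interpret B: normal "pow_roots G b" G by (rule normal_pow_roots[OF B])
  have c: "x \<in> carrier G" "y \<in> carrier G" using x y unfolding mem_pow_roots_iff by blast+
  have "x \<otimes> (y \<otimes> inv x \<otimes> inv y) \<in> pow_roots G a"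
    using x A.inv_op_closed2[OF c(2) A.m_inv_closed[OF x]] by (rule A.m_closed)
  moreover have "(x \<otimes> y \<otimes> inv x) \<otimes> inv y \<in> pow_roots G b"
    using B.inv_op_closed2[OF c(1) y] B.m_inv_closed[OF y] by (rule B.m_closed)
  ultimately have "x \<otimes> y \<otimes> inv x \<otimes> inv y = \<one>"
    using coprime_roots_eq_one[OF _ _ cop] c by (simp add: m_assoc)
  then have "x \<otimes> y \<otimes> inv x = y"
    using c by (metis inv_closed inv_equality inv_inv m_closed)
  then show ?thesis using c by (simp add: conj_eq_iff)
qed

text \<open>The quotient of \<open>P\<close> by its intersection with \<open>N\<close> is a
  nontrivial p-group and has a nontrivial central element; z is a lift of it.\<close>

lemma (in group) prime_power_relative_center:
  assumes p: "Factorial_Ring.prime p" and P: "subgroup P G" "card P = p ^ k"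
    and N: "N \<lhd> G" "\<not> P \<subseteq> N"
  obtains z where "z \<in> P" "z \<notin> N" "\<And>g. g \<in> P \<Longrightarrow> z \<otimes> g \<otimes> inv z \<otimes> inv g \<in> N"
proof -
  define K where "K = G\<lparr>carrier := P\<rparr>"
  define M where "M = N \<inter> P"
  interpret K: group K unfolding K_def by (rule subgroup.subgroup_is_group[OF P(1) is_group])
  have "M \<lhd> K" unfolding M_def K_def by (rule normal_Int_subgroup[OF P(1) N(1)])
  then interpret M: normal M K .
  interpret Q: group "K Mod M" by (rule M.factorgroup_is_group)
  have oK: "order K = p ^ k" using P by (simp add: K_def order_def)
  have "order (K Mod M) dvd p ^ k" using M.order_FactGroup oK dvd_triv_left by metis
  then obtain j where j: "order (K Mod M) = p ^ j" using divides_primepow_nat[OF p] by blast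
  have "j \<noteq> 0"
  proof
    assume "j = 0"
    then have "card M = card P" using M.order_FactGroup j oK P by simp
    moreover have "finite P" using P(2) prime_gt_0_nat[OF p] by (intro card_ge_0_finite) simp
    ultimately have "M = P" by (intro card_subset_eq) (auto simp: M_def)
    then show False using N(2) by (auto simp: M_def)
  qed
  then obtain j' where j': "order (K Mod M) = p ^ Suc j'" using j by (cases j) auto
  obtain A where A: "A \<in> carrier (K Mod M)" "A \<noteq> M"
      "\<And>B. B \<in> carrier (K Mod M) \<Longrightarrow> A \<otimes>\<^bsub>K Mod M\<^esub> B = B \<otimes>\<^bsub>K Mod M\<^esub> A"
    using Q.prime_power_group_center[OF p j'] unfolding one_FactGroup by blast
  then obtain z where z: "z \<in> carrier K" "A = M #>\<^bsub>K\<^esub> z" by (auto simp: carrier_FactGroup)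
  then have zP: "z \<in> P" by (simp add: K_def)
  show thesis
  proof (rule that[OF zP])
    show "z \<notin> N" using M.FactGroup_eq_one_iff[OF z(1)] A(2) z(2) zP by (auto simp: M_def)
    fix g assume g: "g \<in> P"
    then have gK: "g \<in> carrier K" by (simp add: K_def)
    have "M #>\<^bsub>K\<^esub> g \<in> carrier (K Mod M)" using gK by (auto simp: carrier_FactGroup)
    then have "z \<otimes>\<^bsub>K\<^esub> g \<otimes>\<^bsub>K\<^esub> inv\<^bsub>K\<^esub> z \<otimes>\<^bsub>K\<^esub> inv\<^bsub>K\<^esub> g \<in> M"
      using M.commutator_mem_iff[OF z(1) gK] A(3) z(2) by blast
    then have "z \<otimes>\<^bsub>K\<^esub> g \<otimes>\<^bsub>K\<^esub> inv\<^bsub>K\<^esub> z \<otimes>\<^bsub>K\<^esub> inv\<^bsub>K\<^esub> g \<in> N" by (simp add: M_def)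
    then show "z \<otimes> g \<otimes> inv z \<otimes> inv g \<in> N"
      using m_inv_consistent[OF P(1) zP] m_inv_consistent[OF P(1) g] by (simp add: K_def)
  qed
qed

subsection \<open>Nilpotent groups and their Sylow subgroups\<close>

lemma (in group) card_subgroup_dvd:
  assumes "subgroup A G" "subgroup B G" "A \<subseteq> B"
  shows "card A dvd card B"
proof -
  interpret B: group "G\<lparr>carrier := B\<rparr>" by (rule subgroup.subgroup_is_group[OF assms(2) is_group])
  have "card (rcosets\<^bsub>G\<lparr>carrier := B\<rparr>\<^esub> A) * card A = order (G\<lparr>carrier := B\<rparr>)"
    by (rule B.lagrange[OF subgroup_incl[OF assms]])
  then have "card B = card (rcosets\<^bsub>G\<lparr>carrier := B\<rparr>\<^esub> A) * card A" by (simp add: order_def)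
  then show ?thesis by (rule dvdI[OF trans[OF _ mult.commute]])
qed

text \<open>A proper term N of the ascending series misses part of some Sylow solution set, since
  otherwise |G| would divide |N|. An element z of that set, outside N and central in it modulo N,
  also commutes with all elements of order prime to p, so it belongs to the next term.\<close>

lemma (in group) nilpotent_if_roots_subgroups:
  assumes fin: "finite (carrier G)"
    and roots: "\<And>p. Factorial_Ring.prime p \<Longrightarrow> p dvd order G \<Longrightarrow>
      roots_subgroup G (p ^ multiplicity p (order G))"
  shows "nilpotent_group G"
proof (rule nilpotent_if_upper_central_grows[OF fin])
  fix i
  let ?N = "upper_central G i" and ?n = "order G"
  assume ne: "?N \<noteq> carrier G"
  have N: "?N \<lhd> G" by (rule normal_upper_central)
  have subN: "?N \<subseteq> carrier G" using subgroup.subset[OF normal_imp_subgroup[OF N]] .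
  have n0: "?n > 0" using fin order_gt_0_iff_finite by simp
  have "\<exists>p. Factorial_Ring.prime p \<and> p dvd ?n \<and> \<not> pow_roots G (p ^ multiplicity p ?n) \<subseteq> ?N"
  proof (rule ccontr)
    assume *: "\<not> ?thesis"
    have cN0: "card ?N \<noteq> 0"
      using finite_subset[OF subN fin] subgroup.one_closed[OF normal_imp_subgroup[OF N]] by auto
    have "?n dvd card ?N"
    proof (rule multiplicity_le_imp_dvd)
      show "?n \<noteq> 0" using n0 by simp
      fix p :: nat assume p: "Factorial_Ring.prime p"
      show "multiplicity p ?n \<le> multiplicity p (card ?N)"
      proof (cases "p dvd ?n")
        case True
        then have P: "pow_roots G (p ^ multiplicity p ?n) \<subseteq> ?N" using * p by blast
        have r: "roots_subgroup G (p ^ multiplicity p ?n)" by (rule roots[OF p True])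
        have "p ^ multiplicity p ?n dvd card ?N"
          using card_subgroup_dvd[OF _ normal_imp_subgroup[OF N] P] r
          by (simp add: roots_subgroup_def)
        then show ?thesis using cN0 p by (intro multiplicity_geI) auto
      qed (simp add: not_dvd_imp_multiplicity_0)
    qed
    then have "card (carrier G) \<le> card ?N" using cN0 by (simp add: order_def dvd_imp_le)
    then show False using ne card_seteq[OF fin subN] by simp
  qed
  then obtain p where p: "Factorial_Ring.prime p" "p dvd ?n"
      "\<not> pow_roots G (p ^ multiplicity p ?n) \<subseteq> ?N" by blast
  define q where "q = p ^ multiplicity p ?n"
  have q: "roots_subgroup G q" unfolding q_def by (rule roots[OF p(1,2)])
  obtain b where b: "?n = q * b" "\<not> p dvd b" unfolding q_def
  proof (rule multiplicity_decompose'[of ?n p])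
    show "?n \<noteq> 0" "\<not> is_unit p" using n0 p(1) by auto
  qed
  have q0: "q > 0" "b > 0" using b n0 by (auto intro: Nat.gr0I)
  have cop: "coprime q b" unfolding q_def using prime_imp_coprime[OF p(1) b(2)] by simp
  have rb: "roots_subgroup G b"
    using roots_subgroup_hall_divisor[of b q] q0 cop roots b(1)
    by (simp add: mult.commute coprime_commute)
  obtain z where z: "z \<in> pow_roots G q" "z \<notin> ?N"
      "\<And>g. g \<in> pow_roots G q \<Longrightarrow> z \<otimes> g \<otimes> inv z \<otimes> inv g \<in> ?N"
    using prime_power_relative_center[OF p(1) _ _ N p(3), of "multiplicity p ?n"] q
    unfolding roots_subgroup_def q_def by blast
  have zc: "z \<in> carrier G" using z(1) unfolding mem_pow_roots_iff by blast
  have "z \<otimes> g \<otimes> inv z \<otimes> inv g \<in> ?N" if g: "g \<in> carrier G" for g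
  proof -
    have "g \<in> pow_roots G (q * b)"
      using g ord_dvd_group_order[OF g] b(1) by (simp add: mem_pow_roots_iff)
    then obtain u v where uv: "u \<in> pow_roots G q" "v \<in> pow_roots G b" "g = u \<otimes> v"
      by (rule coprime_roots_decompose[OF cop])
    have c: "u \<in> carrier G" "v \<in> carrier G" using uv unfolding mem_pow_roots_iff by blast+
    have "z \<otimes> v = v \<otimes> z"
      using coprime_roots_commute[OF _ _ cop z(1) uv(2)] q rb by (simp add: roots_subgroup_def)
    then have zv: "v \<otimes> inv z = inv z \<otimes> v"
      using c zc by (metis inv_closed inv_solve_left inv_solve_right m_assoc m_closed)
    \<comment> \<open>The factor \<open>v\<close> of g commutes with z and cancels, which leaves the
      commutator of z with the p-part \<open>u\<close>.\<close>
    have "z \<otimes> g \<otimes> inv z \<otimes> inv g = z \<otimes> u \<otimes> (v \<otimes> inv z) \<otimes> inv v \<otimes> inv u"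
      using c zc by (simp add: uv(3) inv_mult_group m_assoc)
    also have "\<dots> = z \<otimes> u \<otimes> inv z \<otimes> inv u"
      unfolding zv using c zc by (simp add: m_assoc)
    finally show ?thesis using z(3)[OF uv(1)] by simp
  qed
  then have "z \<in> upper_central G (Suc i)" using zc by simp
  then show "upper_central G (Suc i) \<noteq> ?N" using z(2) by blast
qed

lemma (in group) lower_central_subset: "lower_central G i \<subseteq> carrier G"
proof (induction i)
  case (Suc i)
  have "h \<otimes> g \<otimes> inv h \<otimes> inv g \<in> carrier G" if "h \<in> lower_central G i" "g \<in> carrier G" for h g
    using subsetD[OF Suc that(1)] that(2) by simp
  then show ?case unfolding lower_central.simps by (intro generate_incl) blast
qed simp

text \<open>Only one inclusion is demanded. For finite \<open>A\<close> conjugation is injective on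
  \<open>A\<close> and hence onto, so this is the usual normalizer and is closed under
  inverses.\<close>

definition normalizing :: "('a, 'b) monoid_scheme \<Rightarrow> 'a set \<Rightarrow> 'a set" where
  "normalizing G A = {g \<in> carrier G. \<forall>a\<in>A. g \<otimes>\<^bsub>G\<^esub> a \<otimes>\<^bsub>G\<^esub> inv\<^bsub>G\<^esub> g \<in> A}"

lemma (in group) subgroup_normalizing:
  assumes "finite A" "A \<subseteq> carrier G"
  shows "subgroup (normalizing G A) G"
proof (rule subgroupI)
  show "normalizing G A \<subseteq> carrier G" by (auto simp: normalizing_def)
  have "\<one> \<in> normalizing G A" using assms by (auto simp: normalizing_def)
  then show "normalizing G A \<noteq> {}" by blast
next
  fix g h assume g: "g \<in> normalizing G A" and h: "h \<in> normalizing G A"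
  then have c: "g \<in> carrier G" "h \<in> carrier G" by (auto simp: normalizing_def)
  have "g \<otimes> h \<otimes> a \<otimes> inv (g \<otimes> h) \<in> A" if a: "a \<in> A" for a
  proof -
    have "g \<otimes> (h \<otimes> a \<otimes> inv h) \<otimes> inv g \<in> A" using g h a by (auto simp: normalizing_def)
    moreover have "a \<in> carrier G" using a assms(2) by blast
    ultimately show ?thesis using c by (simp add: m_assoc inv_mult_group)
  qed
  then show "g \<otimes> h \<in> normalizing G A" using c by (simp add: normalizing_def)
next
  fix g assume g: "g \<in> normalizing G A"
  then have c: "g \<in> carrier G" by (auto simp: normalizing_def)
  have "inj_on (\<lambda>a. g \<otimes> a \<otimes> inv g) A"
    using assms(2) c by (intro inj_onI) (metis conjugation_is_inj subsetD)
  moreover have "(\<lambda>a. g \<otimes> a \<otimes> inv g) ` A \<subseteq> A" using g by (auto simp: normalizing_def)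
  ultimately have surj: "(\<lambda>a. g \<otimes> a \<otimes> inv g) ` A = A" using assms(1) by (simp add: endo_inj_surj)
  have "inv g \<otimes> a \<otimes> inv (inv g) \<in> A" if a: "a \<in> A" for a
  proof -
    have "a \<in> (\<lambda>a. g \<otimes> a \<otimes> inv g) ` A" using a surj by simp
    then obtain b where b: "b \<in> A" "a = g \<otimes> b \<otimes> inv g" by blast
    then have "b \<in> carrier G" using assms(2) by blast
    then have "inv g \<otimes> a \<otimes> inv (inv g) = b" using c unfolding b(2)
      by (simp add: conj_eq_iff m_assoc) (simp flip: m_assoc)
    then show ?thesis using b by simp
  qed
  then show "inv g \<in> normalizing G A" using c by (simp add: normalizing_def)
qed

lemma (in group) subgroup_subset_normalizing: "subgroup A G \<Longrightarrow> A \<subseteq> normalizing G A"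
  by (auto simp: normalizing_def subgroup.mem_carrier subgroup.m_closed subgroup.m_inv_closed)

lemma (in group) normal_in_normalizing:
  assumes "finite A" "subgroup A G"
  shows "A \<lhd> G\<lparr>carrier := normalizing G A\<rparr>"
proof -
  have sub: "subgroup (normalizing G A) G"
    by (rule subgroup_normalizing[OF assms(1) subgroup.subset[OF assms(2)]])
  interpret N: group "G\<lparr>carrier := normalizing G A\<rparr>"
    by (rule subgroup.subgroup_is_group[OF sub is_group])
  show ?thesis
  proof (rule N.normal_invI)
    show "subgroup A (G\<lparr>carrier := normalizing G A\<rparr>)"
      by (rule subgroup_incl[OF assms(2) sub subgroup_subset_normalizing[OF assms(2)]])
    fix x h assume x: "x \<in> carrier (G\<lparr>carrier := normalizing G A\<rparr>)" and h: "h \<in> A"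
    then have "x \<in> normalizing G A" by simp
    then show "x \<otimes>\<^bsub>G\<lparr>carrier := normalizing G A\<rparr>\<^esub> h \<otimes>\<^bsub>G\<lparr>carrier := normalizing G A\<rparr>\<^esub>
        inv\<^bsub>G\<lparr>carrier := normalizing G A\<rparr>\<^esub> x \<in> A"
      using h m_inv_consistent[OF sub] by (simp add: normalizing_def)
  qed
qed

text \<open>Take the first term of the descending series inside \<open>A\<close> and an element g of
  the term before it, outside \<open>A\<close>. Then g a g^-1 is a commutator of g and a times a,
  and both factors lie in \<open>A\<close>.\<close>

lemma (in group) nilpotent_normalizer_grows:
  assumes "nilpotent_group G" and A: "subgroup A G" "A \<noteq> carrier G"
  shows "\<exists>g \<in> normalizing G A. g \<notin> A"
proof -
  obtain c where "lower_central G c = {\<one>}" using assms(1) by (auto simp: nilpotent_group_def)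
  then have c: "lower_central G c \<subseteq> A" using subgroup.one_closed[OF A(1)] by simp
  define i where "i = (LEAST i. lower_central G i \<subseteq> A)"
  have i: "lower_central G i \<subseteq> A" unfolding i_def by (rule LeastI[of _ c]) (rule c)
  have "i \<noteq> 0" using i A(2) subgroup.subset[OF A(1)] by (intro notI) auto
  then obtain j where j: "i = Suc j" by (cases i) auto
  have "\<not> lower_central G j \<subseteq> A" using not_less_Least[of j "\<lambda>i. lower_central G i \<subseteq> A"] j i_def by simp
  then obtain g where g: "g \<in> lower_central G j" "g \<notin> A" by blast
  have gc: "g \<in> carrier G" using g(1) lower_central_subset by blast
  have "g \<otimes> a \<otimes> inv g \<in> A" if a: "a \<in> A" for a
  proof -
    have ac: "a \<in> carrier G" using a subgroup.subset[OF A(1)] by blast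
    have "g \<otimes> a \<otimes> inv g \<otimes> inv a \<in> lower_central G (Suc j)"
      unfolding lower_central.simps by (rule generate.incl) (use g(1) ac in blast)
    then have "g \<otimes> a \<otimes> inv g \<otimes> inv a \<otimes> a \<in> A" using i j a subgroup.m_closed[OF A(1)] by blast
    then show ?thesis using gc ac by (simp add: m_assoc)
  qed
  then have "g \<in> normalizing G A" using gc by (simp add: normalizing_def)
  then show ?thesis using g(2) by blast
qed

text \<open>The order of the image of a solution in the quotient divides both |H| and the order of
  the quotient, so the image is trivial.\<close>

lemma (in normal) coprime_index_roots_subset:
  assumes "coprime (card H) (order (G Mod H))"
  shows "pow_roots G (card H) \<subseteq> H"
proof
  fix x assume "x \<in> pow_roots G (card H)"
  then have x: "x \<in> carrier G" "x [^] card H = \<one>" by (auto simp: pow_roots_def)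
  interpret Q: group "G Mod H" by (rule factorgroup_is_group)
  have A: "H #> x \<in> carrier (G Mod H)" using x by (auto simp: carrier_FactGroup)
  have "(H #> x) [^]\<^bsub>G Mod H\<^esub> card H = \<one>\<^bsub>G Mod H\<^esub>"
    using FactGroup_pow[OF x(1)] x(2) subset by simp
  then have "H #> x \<in> pow_roots (G Mod H) (card H)" using A by (simp add: pow_roots_def)
  moreover have "H #> x \<in> pow_roots (G Mod H) (order (G Mod H))"
    using A Q.ord_dvd_group_order unfolding Q.mem_pow_roots_iff by blast
  ultimately have "H #> x = H" using Q.coprime_roots_eq_one[OF _ _ assms] by simp
  then show "x \<in> H" using FactGroup_eq_one_iff[OF x(1)] by simp
qed

text \<open>\<open>P\<close> is a full Sylow subgroup, so the solutions inside its normalizer N are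
  exactly the elements of \<open>P\<close>. Whatever normalizes N therefore normalizes
  \<open>P\<close>, that is, N is its own normalizer; in a nilpotent group this forces N to be
  everything.\<close>

lemma (in group) nilpotent_roots_subgroup:
  assumes fin: "finite (carrier G)" and nil: "nilpotent_group G" and p: "Factorial_Ring.prime p"
    and ord: "order G = p ^ k * m" and cop: "coprime (p ^ k) m"
  shows "roots_subgroup G (p ^ k)"
proof -
  obtain P where P: "subgroup P G" "card P = p ^ k" using sylow_thm[OF p is_group ord fin] by blast
  define N where "N = normalizing G P"
  define K where "K = G\<lparr>carrier := N\<rparr>"
  have Psub: "P \<subseteq> carrier G" by (rule subgroup.subset[OF P(1)])
  have N: "subgroup N G"
    unfolding N_def by (rule subgroup_normalizing[OF finite_subset[OF Psub fin] Psub])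
  have PN: "P \<subseteq> N" unfolding N_def by (rule subgroup_subset_normalizing[OF P(1)])
  have "P \<lhd> K" unfolding K_def N_def
    by (rule normal_in_normalizing[OF finite_subset[OF Psub fin] P(1)])
  then interpret P: normal P K .
  have "order (K Mod P) * p ^ k = card N" using P.order_FactGroup P(2) by (simp add: K_def order_def)
  then have "order (K Mod P) * p ^ k dvd p ^ k * m"
    using card_subgroup_dvd[OF N subgroup_self subgroup.subset[OF N]] ord by (simp add: order_def)
  then have "order (K Mod P) dvd m" using prime_gt_0_nat[OF p] by (simp add: mult.commute)
  then have "coprime (card P) (order (K Mod P))" using cop P(2)
    by (metis coprime_divisors dvd_refl)
  then have "pow_roots K (card P) \<subseteq> P" by (rule P.coprime_index_roots_subset)
  then have roots: "pow_roots G (p ^ k) \<inter> N \<subseteq> P"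
    using pow_roots_carrier_update[OF subgroup.subset[OF N], of "p ^ k"] P(2) by (simp add: K_def)
  have Proots: "P \<subseteq> pow_roots G (p ^ k)" by (rule subgroup_subset_pow_roots[OF P(1)]) (simp add: P(2))
  have "N = carrier G"
  proof (rule ccontr)
    assume "N \<noteq> carrier G"
    then obtain g where g: "g \<in> normalizing G N" "g \<notin> N"
      using nilpotent_normalizer_grows[OF nil N] by blast
    have gc: "g \<in> carrier G" using g(1) by (simp add: normalizing_def)
    have "g \<otimes> a \<otimes> inv g \<in> P" if a: "a \<in> P" for a
    proof -
      have ac: "a \<in> carrier G" using a Psub by blast
      have "g \<otimes> a \<otimes> inv g \<in> N" using g(1) a PN by (auto simp: normalizing_def)
      moreover have "a \<in> pow_roots G (p ^ k)" using a Proots by blast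
      then have "g \<otimes> a \<otimes> inv g \<in> pow_roots G (p ^ k)"
        using ord_conj[OF gc ac] gc ac by (simp add: mem_pow_roots_iff)
      ultimately show ?thesis using roots by blast
    qed
    then show False using g(2) gc by (simp add: N_def normalizing_def)
  qed
  then have "pow_roots G (p ^ k) \<subseteq> P" using roots by (auto simp: pow_roots_def)
  then have "pow_roots G (p ^ k) = P" using Proots by blast
  then show ?thesis using P by (simp add: roots_subgroup_def)
qed

subsection \<open>A unique nilpotent subgroup of given order\<close>

text \<open>The coset of g has order exactly p, and \<open>B\<close> is the preimage of the cyclic
  subgroup that it generates.\<close>

lemma (in normal) prime_index_extension:
  assumes p: "Factorial_Ring.prime p" and g: "g \<in> carrier G" "g \<notin> H" "g [^] p \<in> H"
  obtains B where "subgroup B G" "H \<subseteq> B" "g \<in> B" "card B = p * card H"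
proof -
  interpret Q: group "G Mod H" by (rule factorgroup_is_group)
  have gQ: "H #> g \<in> carrier (G Mod H)" using g by (auto simp: carrier_FactGroup)
  have "(H #> g) [^]\<^bsub>G Mod H\<^esub> p = \<one>\<^bsub>G Mod H\<^esub>"
    using FactGroup_pow[OF g(1)] FactGroup_eq_one_iff[of "g [^] p"] g by simp
  then have "Q.ord (H #> g) dvd p" using Q.pow_eq_id[OF gQ] by simp
  moreover have "Q.ord (H #> g) \<noteq> 1" using Q.ord_eq_1[OF gQ] FactGroup_eq_one_iff[OF g(1)] g(2) by simp
  ultimately have o: "Q.ord (H #> g) = p" using p by (auto simp: prime_nat_iff)
  define A where "A = generate (G Mod H) {H #> g}"
  have A: "subgroup A (G Mod H)" unfolding A_def using gQ by (intro Q.generate_is_subgroup) simp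
  have cA: "card A = p" unfolding A_def using Q.generate_pow_card[OF gQ] o by simp
  have U: "\<Union>A = {x \<in> carrier G. H #> x \<in> A}" by (rule factgroup_subgroup_union_char[OF A])
  have B: "subgroup (\<Union>A) G" by (rule factgroup_subgroup_union_subgroup[OF A])
  have HB: "H \<subseteq> \<Union>A"
  proof
    fix x assume x: "x \<in> H"
    then have xc: "x \<in> carrier G" using subset by blast
    have "H \<in> A" using subgroup.one_closed[OF A] by simp
    then have "H #> x \<in> A" using FactGroup_eq_one_iff[OF xc] x by simp
    then show "x \<in> \<Union>A" using xc unfolding U by simp
  qed
  have "H #> g \<in> A" unfolding A_def by (rule generate.incl) simp
  then have gB: "g \<in> \<Union>A" using g(1) unfolding U by simp
  interpret B: group "G\<lparr>carrier := \<Union>A\<rparr>" by (rule subgroup.subgroup_is_group[OF B is_group])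
  have "card (rcosets\<^bsub>G\<lparr>carrier := \<Union>A\<rparr>\<^esub> H) * card H = order (G\<lparr>carrier := \<Union>A\<rparr>)"
    by (rule B.lagrange[OF subgroup_incl[OF is_subgroup B HB]])
  then have "card (\<Union>A) = p * card H"
    using factgroup_subgroup_union_factor[OF A] cA by (simp add: order_def)
  then show thesis by (rule that[OF B HB gB])
qed

text \<open>The sequence x, x^p, x^(p^2), ... starts outside \<open>A\<close> and reaches it. Where
  it enters, it yields an element as \<open>prime_index_extension\<close> requires.\<close>

lemma (in group) first_power_in_subset:
  assumes "x \<in> carrier G" "x \<notin> A" "x [^] (p ^ t) \<in> A"
  obtains j where "x [^] (p ^ j) \<notin> A" "(x [^] (p ^ j)) [^] (p :: nat) \<in> A"
proof -
  have "\<exists>j. x [^] (p ^ j) \<notin> A \<and> x [^] (p ^ Suc j) \<in> A"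
    using assms(3)
  proof (induction t)
    case 0
    then show ?case using assms(1,2) by simp
  next
    case (Suc t)
    then show ?case by (cases "x [^] (p ^ t) \<in> A") auto
  qed
  then obtain j where "x [^] (p ^ j) \<notin> A" "x [^] (p ^ Suc j) \<in> A" by blast
  then show thesis using that[of j] assms(1) by (simp add: nat_pow_pow mult.commute)
qed

text \<open>The group is its own Sylow subgroup and the full solution set of x^|G| = 1, so the
  criterion by solution sets applies.\<close>

lemma (in group) prime_power_group_nilpotent:
  assumes p: "Factorial_Ring.prime p" and ord: "order G = p ^ k"
  shows "nilpotent_group G"
proof -
  have "order G > 0" using ord prime_gt_0_nat[OF p] by simp
  then have fin: "finite (carrier G)" using order_gt_0_iff_finite by simp
  have "pow_roots G (order G) = carrier G" using ord_dvd_group_order by (auto simp: mem_pow_roots_iff)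
  then have roots: "roots_subgroup G (order G)" by (simp add: roots_subgroup_def order_def subgroup_self)
  show ?thesis
  proof (rule nilpotent_if_roots_subgroups[OF fin])
    fix q :: nat assume q: "Factorial_Ring.prime q" "q dvd order G"
    then have "q dvd p" using prime_dvd_power[OF q(1)] unfolding ord by simp
    then have "q = p" by (rule primes_dvd_imp_eq[OF q(1) p])
    then have "q ^ multiplicity q (order G) = order G" using ord p by simp
    then show "roots_subgroup G (q ^ multiplicity q (order G))" using roots by simp
  qed
qed

text \<open>Start with the cyclic subgroup of y, whose order divides p^k, and enlarge it by a factor
  p at a time inside successive normalizers.\<close>

lemma (in group) prime_power_subgroup_containing:
  assumes p: "Factorial_Ring.prime p" and ord: "order G = p ^ n" and k: "k \<le> n"
    and y: "y \<in> carrier G" "y [^] (p ^ k) = \<one>"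
  shows "\<exists>A. subgroup A G \<and> card A = p ^ k \<and> y \<in> A"
proof -
  have "order G > 0" using ord prime_gt_0_nat[OF p] by simp
  then have fin: "finite (carrier G)" using order_gt_0_iff_finite by simp
  have nil: "nilpotent_group G" by (rule prime_power_group_nilpotent[OF p ord])
  have "local.ord y dvd p ^ k" using y pow_eq_id by simp
  then obtain e where e: "e \<le> k" "local.ord y = p ^ e" using divides_primepow_nat[OF p] by blast
  from e(1) k show ?thesis
  proof (induction k rule: dec_induct)
    case base
    have "y \<in> generate G {y}" by (rule generate.incl) simp
    then show ?case using generate_is_subgroup[of "{y}"] generate_pow_card[OF y(1)] e(2) y(1)
      by (intro exI[of _ "generate G {y}"]) auto
  next
    case (step i)
    then obtain A where A: "subgroup A G" "card A = p ^ i" "y \<in> A" by auto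
    have "p ^ i < p ^ n" using step prime_gt_1_nat[OF p] by (intro power_strict_increasing) auto
    then have "A \<noteq> carrier G" using A(2) ord by (auto simp: order_def)
    then obtain g where g: "g \<in> normalizing G A" "g \<notin> A"
      using nilpotent_normalizer_grows[OF nil A(1)] by blast
    define K where "K = G\<lparr>carrier := normalizing G A\<rparr>"
    have finA: "finite A" by (rule finite_subset[OF subgroup.subset[OF A(1)] fin])
    have NA: "subgroup (normalizing G A) G"
      by (rule subgroup_normalizing[OF finA subgroup.subset[OF A(1)]])
    have "A \<lhd> K" unfolding K_def by (rule normal_in_normalizing[OF finA A(1)])
    then interpret A: normal A K .
    have gK: "g \<in> carrier K" using g(1) by (simp add: K_def)
    have "g \<in> carrier G" using g(1) by (simp add: normalizing_def)
    then have "g [^] (p ^ n) = \<one>" using pow_order_eq_1 ord by metis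
    then have "g [^]\<^bsub>K\<^esub> (p ^ n) \<in> A"
      using subgroup.one_closed[OF A(1)] by (simp add: K_def nat_pow_def)
    \<comment> \<open>An arbitrary g in the normalizer may have its p-th power outside
      \<open>A\<close>; a suitable power of g is used instead, so that the order grows by exactly
      one factor p.\<close>
    then obtain j where j: "g [^]\<^bsub>K\<^esub> (p ^ j) \<notin> A" "(g [^]\<^bsub>K\<^esub> (p ^ j)) [^]\<^bsub>K\<^esub> p \<in> A"
      by (rule A.first_power_in_subset[OF gK g(2)])
    obtain B where B: "subgroup B K" "A \<subseteq> B" "card B = p * card A"
      using A.prime_index_extension[OF p _ j] gK by auto
    have "subgroup B G" using incl_subgroup[OF NA] B(1) by (simp add: K_def)
    then show ?case using B A by (intro exI[of _ B]) auto
  qed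
qed

section \<open>Solution counts forced by a unique nilpotent subgroup\<close>

lemma (in group) unique_subgroup_normal:
  assumes fin: "finite (carrier G)" and H: "subgroup H G"
    and uniq: "\<And>K. subgroup K G \<Longrightarrow> card K = card H \<Longrightarrow> K = H"
  shows "H \<lhd> G"
proof (rule normal_invI[OF H])
  fix x h assume x: "x \<in> carrier G" and h: "h \<in> H"
  have eq: "x <# H #> inv x = (\<lambda>a. x \<otimes> a \<otimes> inv x) ` H" by (auto simp: l_coset_def r_coset_def)
  have "inj_on (\<lambda>a. x \<otimes> a \<otimes> inv x) H"
  proof (rule inj_onI)
    fix a b assume "a \<in> H" "b \<in> H" "x \<otimes> a \<otimes> inv x = x \<otimes> b \<otimes> inv x"
    then show "a = b" using x subgroup.mem_carrier[OF H] by simp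
  qed
  then have "card (x <# H #> inv x) = card H" unfolding eq by (rule card_image)
  then have "x <# H #> inv x = H" by (rule uniq[OF subgroup_conjugation_is_surj2[OF x H]])
  then show "x \<otimes> h \<otimes> inv x \<in> H" using h eq by blast
qed

lemma (in group) normal_Int_pow_roots:
  assumes "H \<lhd> G" "subgroup (pow_roots (G\<lparr>carrier := H\<rparr>) m) (G\<lparr>carrier := H\<rparr>)"
  shows "pow_roots (G\<lparr>carrier := H\<rparr>) m \<lhd> G"
proof (rule normal_invI)
  interpret H: normal H G by (rule assms(1))
  have eq: "pow_roots (G\<lparr>carrier := H\<rparr>) m = pow_roots G m \<inter> H"
    by (rule pow_roots_carrier_update[OF H.subset])
  show "subgroup (pow_roots (G\<lparr>carrier := H\<rparr>) m) G"
    by (rule incl_subgroup[OF H.is_subgroup assms(2)])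
  fix x h assume x: "x \<in> carrier G" and "h \<in> pow_roots (G\<lparr>carrier := H\<rparr>) m"
  then have h: "h \<in> carrier G" "ord h dvd m" "h \<in> H" unfolding eq by (auto simp: mem_pow_roots_iff)
  show "x \<otimes> h \<otimes> inv x \<in> pow_roots (G\<lparr>carrier := H\<rparr>) m"
    unfolding eq using x h H.inv_op_closed2[OF x h(3)] by (simp add: mem_pow_roots_iff ord_conj)
qed

text \<open>By nilpotence the solutions of x^(p^k) = 1 inside \<open>H\<close> form a subgroup of
  order p^k, so it suffices that no solution lies outside \<open>H\<close>.\<close>

lemma (in group) card_pow_roots_of_unique_nilpotent:
  assumes fin: "finite (carrier G)" and H: "subgroup H G" "card H = p ^ k * m"
    and uniq: "\<And>K. subgroup K G \<Longrightarrow> card K = card H \<Longrightarrow> K = H"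
    and nil: "nilpotent_group (G\<lparr>carrier := H\<rparr>)"
    and p: "Factorial_Ring.prime p" and cop: "coprime (p ^ k) m" and m: "roots_subgroup (G\<lparr>carrier := H\<rparr>) m"
  shows "card (pow_roots G (p ^ k)) = p ^ k"
proof -
  define K where "K = G\<lparr>carrier := H\<rparr>"
  define P where "P = pow_roots K (p ^ k)"
  define Q where "Q = pow_roots K m"
  interpret K: group K unfolding K_def by (rule subgroup.subgroup_is_group[OF H(1) is_group])
  have Hsub: "H \<subseteq> carrier G" by (rule subgroup.subset[OF H(1)])
  have finK: "finite (carrier K)" unfolding K_def using finite_subset[OF Hsub fin] by simp
  have oK: "order K = p ^ k * m" using H(2) by (simp add: K_def order_def)
  have "roots_subgroup K (p ^ k)"
    by (rule K.nilpotent_roots_subgroup[OF finK _ p oK cop]) (use nil in \<open>simp add: K_def\<close>)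
  then have P: "subgroup P K" "card P = p ^ k" by (auto simp: roots_subgroup_def P_def)
  have Q: "subgroup Q K" "card Q = m" using m by (auto simp: roots_subgroup_def Q_def K_def)
  \<comment> \<open>Normality passes from \<open>H\<close> to \<open>P\<close> and \<open>Q\<close>,
    which are cut out of \<open>H\<close> by element orders. It lets \<open>P\<close> be extended by
    an outside element and makes \<open>Q <#> A\<close> a subgroup.\<close>
  have nH: "H \<lhd> G" by (rule unique_subgroup_normal[OF fin H(1) uniq])
  have nP: "P \<lhd> G" and nQ: "Q \<lhd> G"
    using normal_Int_pow_roots[OF nH] P(1) Q(1) by (auto simp: P_def Q_def K_def)
  have Peq: "P = pow_roots G (p ^ k) \<inter> H"
    unfolding P_def K_def by (rule pow_roots_carrier_update[OF Hsub])
  interpret P: normal P G by (rule nP)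
  have "pow_roots G (p ^ k) \<subseteq> H"
  proof (rule ccontr)
    assume "\<not> ?thesis"
    then obtain x where x: "x \<in> carrier G" "x [^] (p ^ k) = \<one>" "x \<notin> H" by (auto simp: pow_roots_def)
    have "x [^] (p ^ k) \<in> H" using x(2) subgroup.one_closed[OF H(1)] by simp
    then obtain j where j: "x [^] (p ^ j) \<notin> H" "(x [^] (p ^ j)) [^] p \<in> H"
      by (rule first_power_in_subset[OF x(1,3)])
    define y where "y = x [^] (p ^ j)"
    have y: "y \<in> carrier G" "y \<notin> H" "y [^] p \<in> H" using x(1) j by (auto simp: y_def)
    have "y [^] (p ^ k) = (x [^] (p ^ k)) [^] (p ^ j)"
      using x(1) by (simp add: y_def nat_pow_pow mult.commute)
    then have yk: "y [^] (p ^ k) = \<one>" using x(2) by simp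
    have "(y [^] p) [^] (p ^ k) = (y [^] (p ^ k)) [^] p"
      using y(1) by (simp add: nat_pow_pow mult.commute)
    \<comment> \<open>Since y^p lies even in \<open>P\<close>, the extension \<open>S\<close> has
      order p^(k+1) and is a p-group.\<close>
    then have "y [^] p \<in> P" using y yk unfolding Peq by (simp add: pow_roots_def)
    moreover have "y \<notin> P" using y(2) unfolding Peq by simp
    ultimately obtain S where S: "subgroup S G" "y \<in> S" "card S = p * card P"
      using P.prime_index_extension[OF p y(1)] by blast
    interpret S: group "G\<lparr>carrier := S\<rparr>" by (rule subgroup.subgroup_is_group[OF S(1) is_group])
    have "order (G\<lparr>carrier := S\<rparr>) = p ^ Suc k" using S(3) P(2) by (simp add: order_def)
    then have "\<exists>A. subgroup A (G\<lparr>carrier := S\<rparr>) \<and> card A = p ^ k \<and> y \<in> A"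
      by (rule S.prime_power_subgroup_containing[OF p]) (use S(2) yk in \<open>simp_all add: nat_pow_def\<close>)
    then obtain A where A: "subgroup A (G\<lparr>carrier := S\<rparr>)" "card A = p ^ k" "y \<in> A" by blast
    have AG: "subgroup A G" by (rule incl_subgroup[OF S(1) A(1)])
    have "card (Q <#> A) = card Q * card A"
      by (rule card_set_mult_coprime[OF normal_imp_subgroup[OF nQ] AG])
         (use cop A(2) Q(2) in \<open>simp add: coprime_commute\<close>)
    then have "card (Q <#> A) = card H" using A(2) Q(2) H(2) by simp
    then have "Q <#> A = H" by (rule uniq[OF mult_norm_subgroup[OF nQ AG]])
    moreover have "y \<in> Q <#> A"
      using subgroup.one_closed[OF normal_imp_subgroup[OF nQ]] A(3) y(1) unfolding set_mult_def by force
    ultimately show False using y(2) by blast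
  qed
  then have "pow_roots G (p ^ k) = P" unfolding Peq by blast
  then show ?thesis using P(2) by simp
qed

theorem (in group) card_prime_power_roots_iff_unique_nilpotent:
  assumes fin: "finite (carrier G)" and n0: "n > 0" and n: "n dvd order G"
  shows "(\<forall>p \<in> prime_factors n. card (pow_roots G (p ^ multiplicity p n)) = p ^ multiplicity p n)
    \<longleftrightarrow> (\<exists>!H. subgroup H G \<and> card H = n) \<and>
        (\<forall>H. subgroup H G \<and> card H = n \<longrightarrow> nilpotent_group (G\<lparr>carrier := H\<rparr>))"
    (is "?lhs \<longleftrightarrow> ?rhs")
proof
  assume l: ?lhs
  have roots: "roots_subgroup G (p ^ multiplicity p n)"
    if "Factorial_Ring.prime p" "p dvd n" for p
  proof (rule roots_subgroup_prime_power[OF fin that(1)])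
    show "p ^ multiplicity p n dvd order G" by (rule dvd_trans[OF multiplicity_dvd n])
    show "card (pow_roots G (p ^ multiplicity p n)) = p ^ multiplicity p n"
      using l that n0 by (simp add: prime_factors_dvd)
  qed
  define V where "V = pow_roots G n"
  define K where "K = G\<lparr>carrier := V\<rparr>"
  have "roots_subgroup G n" by (rule roots_subgroup_of_prime_powers[OF n0 roots])
  then have V: "subgroup V G" "card V = n" by (auto simp: roots_subgroup_def V_def)
  have uniq: "H = V" if "subgroup H G \<and> card H = n" for H
    using subgroup_eq_pow_roots[OF fin, of H n] that V by (simp add: V_def)
  interpret K: group K unfolding K_def by (rule subgroup.subgroup_is_group[OF V(1) is_group])
  have Vsub: "V \<subseteq> carrier G" by (rule subgroup.subset[OF V(1)])
  have oK: "order K = n" using V by (simp add: K_def order_def)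
  have finK: "finite (carrier K)" unfolding K_def using finite_subset[OF Vsub fin] by simp
  have "nilpotent_group K"
  proof (rule K.nilpotent_if_roots_subgroups[OF finK], unfold oK)
    fix p assume p: "Factorial_Ring.prime p" "p dvd n"
    let ?q = "p ^ multiplicity p n"
    \<comment> \<open>As \<open>?q\<close> divides \<open>n\<close>, the subgroup \<open>V\<close>
      already contains all solutions in \<open>G\<close>, so the solution sets of \<open>G\<close>
      and of \<open>V\<close> agree.\<close>
    have sub: "pow_roots G ?q \<subseteq> V"
      using multiplicity_dvd[of p n] unfolding V_def
      by (auto simp: mem_pow_roots_iff intro: dvd_trans[of _ "p ^ multiplicity p n" n])
    then have "pow_roots K ?q = pow_roots G ?q"
      using pow_roots_carrier_update[OF Vsub, of ?q] by (auto simp: K_def)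
    then show "roots_subgroup K ?q"
      using roots[OF p] subgroup_incl[OF _ V(1) sub] by (simp add: roots_subgroup_def K_def)
  qed
  then have "nilpotent_group (G\<lparr>carrier := V\<rparr>)" unfolding K_def .
  then show ?rhs using V uniq by blast
next
  assume r: ?rhs
  then obtain H where H: "subgroup H G" "card H = n" by blast
  have uniq: "L = H" if "subgroup L G" "card L = card H" for L using r H that by auto
  have nil: "nilpotent_group (G\<lparr>carrier := H\<rparr>)" using r H by blast
  define K where "K = G\<lparr>carrier := H\<rparr>"
  interpret K: group K unfolding K_def by (rule subgroup.subgroup_is_group[OF H(1) is_group])
  have finK: "finite (carrier K)"
    unfolding K_def using finite_subset[OF subgroup.subset[OF H(1)] fin] by simp
  have oK: "order K = n" using H by (simp add: K_def order_def)
  have decomp: "\<exists>b. n = p ^ multiplicity p n * b \<and> coprime (p ^ multiplicity p n) b \<and> b > 0"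
    if p: "Factorial_Ring.prime p" for p
  proof -
    obtain b where b: "n = p ^ multiplicity p n * b" "\<not> p dvd b"
    proof (rule multiplicity_decompose'[of n p])
      show "n \<noteq> 0" "\<not> is_unit p" using n0 p by auto
    qed
    then have "b > 0" by (intro Nat.gr0I) auto
    moreover have "coprime (p ^ multiplicity p n) b" using prime_imp_coprime[OF p b(2)] by simp
    ultimately show ?thesis using b(1) by blast
  qed
  have rootsK: "roots_subgroup K (p ^ multiplicity p n)" if p: "Factorial_Ring.prime p" for p
  proof -
    obtain b where "n = p ^ multiplicity p n * b" "coprime (p ^ multiplicity p n) b"
      using decomp[OF p] by blast
    then show ?thesis
      using K.nilpotent_roots_subgroup[OF finK _ p, of "multiplicity p n" b] nil oK by (simp add: K_def)
  qed
  show ?lhs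
  proof
    fix p assume "p \<in> prime_factors n"
    then have p: "Factorial_Ring.prime p" by auto
    obtain b where b: "n = p ^ multiplicity p n * b" "coprime (p ^ multiplicity p n) b" "b > 0"
      using decomp[OF p] by blast
    define q where "q = p ^ multiplicity p n"
    have nq: "n = b * q" using b(1) by (simp add: q_def mult.commute)
    \<comment> \<open>This is the Hall subgroup complementary to the Sylow p-subgroup of
      \<open>H\<close>, obtained from the other Sylow subgroups of \<open>H\<close>.\<close>
    have "roots_subgroup K b"
    proof (rule K.roots_subgroup_hall_divisor[OF b(3)])
      show "q > 0" unfolding q_def using prime_gt_0_nat[OF p] by simp
      show "coprime b q" using b(2) unfolding q_def by (simp add: coprime_commute)
    qed (unfold nq[symmetric], rule rootsK)
    then show "card (pow_roots G (p ^ multiplicity p n)) = p ^ multiplicity p n"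
      using card_pow_roots_of_unique_nilpotent[OF fin H(1) _ uniq nil p b(2)] H(2) b(1)
      by (simp add: K_def)
  qed
qed

subsection \<open>Expansion over sets of primes\<close>

definition hall_part :: "nat \<Rightarrow> nat set \<Rightarrow> nat" where
  "hall_part n A = (\<Prod>p\<in>A. p ^ multiplicity p n)"

lemma hall_part_mult:
  assumes "n > 0" "A \<subseteq> prime_factors n"
  shows "n = hall_part n A * hall_part n (prime_factors n - A)"
    and "coprime (hall_part n A) (hall_part n (prime_factors n - A))"
    and "hall_part n A > 0"
proof -
  have "n = (\<Prod>p\<in>prime_factors n. p ^ multiplicity p n)"
    using assms(1) by (simp add: prod_prime_factors)
  then show "n = hall_part n A * hall_part n (prime_factors n - A)"
    unfolding hall_part_def using prod.subset_diff[OF assms(2), of "\<lambda>p. p ^ multiplicity p n"]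
    by (simp add: mult.commute)
  then show "hall_part n A > 0" using assms(1) by (intro Nat.gr0I) auto
  show "coprime (hall_part n A) (hall_part n (prime_factors n - A))"
    unfolding hall_part_def
  proof (intro prod_coprime_left prod_coprime_right)
    fix p q assume "p \<in> A" "q \<in> prime_factors n - A"
    then have "Factorial_Ring.prime p" "Factorial_Ring.prime q" "p \<noteq> q" using assms(2) by auto
    then have "coprime p q" by (rule primes_coprime)
    then show "coprime (p ^ multiplicity p n) (q ^ multiplicity q n)" by simp
  qed
qed

text \<open>The exponents of a divisor of \<open>n\<close> never exceed those of \<open>n\<close>,
  so only the set of its primes matters.\<close>

lemma dvd_hall_part_iff:
  assumes "n > 0" "d dvd n" "A \<subseteq> prime_factors n"
  shows "d dvd hall_part n A \<longleftrightarrow> prime_factors d \<subseteq> A"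
proof -
  have d0: "d \<noteq> 0" using assms(1,2) by auto
  have h0: "hall_part n A \<noteq> 0" using hall_part_mult(3)[OF assms(1,3)] by simp
  have finA: "finite A" by (rule finite_subset[OF assms(3)]) simp
  have mult: "multiplicity q (hall_part n A) = (if q \<in> A then multiplicity q n else 0)"
    if "Factorial_Ring.prime q" for q
    unfolding hall_part_def using assms(3) that finA by (intro multiplicity_prod_prime_powers) auto
  show ?thesis
  proof
    assume "d dvd hall_part n A"
    then have le: "multiplicity q d \<le> multiplicity q (hall_part n A)" for q
      using h0 by (rule dvd_imp_multiplicity_le)
    show "prime_factors d \<subseteq> A"
    proof
      fix q assume "q \<in> prime_factors d"
      then have q: "Factorial_Ring.prime q" "multiplicity q d > 0"
        by (auto simp: prime_factors_multiplicity)
      then show "q \<in> A" using le[of q] mult[OF q(1)] by (cases "q \<in> A") auto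
    qed
  next
    assume sub: "prime_factors d \<subseteq> A"
    show "d dvd hall_part n A"
    proof (rule multiplicity_le_imp_dvd[OF d0])
      fix q :: nat assume q: "Factorial_Ring.prime q"
      show "multiplicity q d \<le> multiplicity q (hall_part n A)"
      proof (cases "q \<in> A")
        case True
        then show ?thesis using mult[OF q] dvd_imp_multiplicity_le[OF assms(2)] assms(1) by simp
      next
        case False
        then have "q \<notin> prime_factors d" using sub by blast
        then show ?thesis using q by (simp add: prime_factors_multiplicity)
      qed
    qed
  qed
qed

text \<open>The coefficient of one term of the expanded product: c_p for the primes in
  \<open>A\<close> and 1 - c_p for the others, where c_p = (1 - 1/p)^(-r).\<close>

definition hall_weight :: "real \<Rightarrow> nat \<Rightarrow> nat set \<Rightarrow> real" where
  "hall_weight r n A = (\<Prod>p\<in>A. (1 - 1 / real p) powr (- r)) *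
     (\<Prod>p\<in>prime_factors n - A. 1 - (1 - 1 / real p) powr (- r))"

text \<open>With -r > 0 the power of 1 - 1/p lies strictly between 0 and 1, so both kinds of factors
  are positive.\<close>

lemma hall_weight_pos:
  assumes "r < 0" "A \<subseteq> prime_factors n"
  shows "hall_weight r n A > 0"
proof -
  have "0 < (1 - 1 / real p) powr (- r) \<and> (1 - 1 / real p) powr (- r) < 1" if "Factorial_Ring.prime p" for p
  proof -
    have "0 < 1 - 1 / real p" "1 - 1 / real p < 1" using prime_gt_1_nat[OF that] by auto
    then show ?thesis using powr_less_mono2[of "- r" "1 - 1 / real p" 1] assms(1) by simp
  qed
  then show ?thesis unfolding hall_weight_def using assms(2)
    by (intro mult_pos_pos prod_pos) (force simp: in_prime_factors_iff)+
qed

lemma totient_ratio_powr: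
  assumes "d > 0"
  shows "(real d / real (totient d)) powr r = (\<Prod>p\<in>prime_factors d. (1 - 1 / real p) powr (- r))"
proof -
  let ?P = "\<Prod>p\<in>prime_factors d. 1 - 1 / real p"
  have nn: "0 \<le> 1 - 1 / real p" if "p \<in> prime_factors d" for p
    using prime_gt_1_nat[OF in_prime_factors_imp_prime[OF that]] by simp
  have "real d / real (totient d) = inverse ?P"
    unfolding totient_formula2 using assms by (simp add: field_simps)
  then have "(real d / real (totient d)) powr r = ?P powr (- r)"
    using prod_nonneg[of "prime_factors d" "\<lambda>p. 1 - 1 / real p"] nn by (simp add: inverse_powr powr_minus)
  also have "\<dots> = (\<Prod>p\<in>prime_factors d. (1 - 1 / real p) powr (- r))"
    by (rule prod_powr_distrib)
  finally show ?thesis .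
qed

text \<open>Write every factor missing from the product as \<open>c\<^sub>p + (1 - c\<^sub>p)\<close> and expand.\<close>

lemma totient_ratio_powr_expansion:
  assumes "n > 0" "d dvd n"
  shows "(real d / real (totient d)) powr r
    = (\<Sum>A\<in>Pow (prime_factors n). hall_weight r n A * (if d dvd hall_part n A then 1 else 0))"
proof -
  define c where "c p = (1 - 1 / real p) powr (- r)" for p :: nat
  \<comment> \<open>\<open>g\<close> is 0 at the primes of \<open>d\<close>, so every term whose
    \<open>A\<close> omits a prime of \<open>d\<close> vanishes; the remaining \<open>A\<close> are
    those for which \<open>d\<close> divides the \<open>A\<close>-part of \<open>n\<close>.\<close>
  define g where "g p = (if p dvd d then 0 else 1 - c p)" for p
  have d0: "d > 0" using assms by (intro Nat.gr0I) auto
  have sub: "prime_factors d \<subseteq> prime_factors n" using assms by (intro dvd_prime_factors) auto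
  have "(real d / real (totient d)) powr r = (\<Prod>p\<in>prime_factors d. c p)"
    unfolding c_def by (rule totient_ratio_powr[OF d0])
  also have "\<dots> = (\<Prod>p\<in>prime_factors n. c p + g p)"
    using sub d0 by (intro prod.mono_neutral_cong_left) (auto simp: g_def in_prime_factors_iff)
  also have "\<dots> = (\<Sum>A\<in>Pow (prime_factors n). prod c A * prod g (prime_factors n - A))"
    by (rule prod_add) simp
  also have "\<dots> = (\<Sum>A\<in>Pow (prime_factors n).
      hall_weight r n A * (if d dvd hall_part n A then 1 else 0))"
  proof (rule sum.cong[OF refl])
    fix A assume "A \<in> Pow (prime_factors n)"
    then have A: "A \<subseteq> prime_factors n" by simp
    show "prod c A * prod g (prime_factors n - A)
        = hall_weight r n A * (if d dvd hall_part n A then 1 else 0)"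
    proof (cases "prime_factors d \<subseteq> A")
      case True
      then have "prod g (prime_factors n - A) = (\<Prod>p\<in>prime_factors n - A. 1 - c p)"
        using d0 by (intro prod.cong) (auto simp: g_def in_prime_factors_iff)
      then show ?thesis using True dvd_hall_part_iff[OF assms A] by (simp add: hall_weight_def c_def)
    next
      case False
      then have "prod g (prime_factors n - A) = 0"
        using sub by (intro prod_zero) (auto simp: g_def in_prime_factors_iff)
      then show ?thesis using False dvd_hall_part_iff[OF assms A] by simp
    qed
  qed
  finally show ?thesis .
qed

text \<open>After the sums are interchanged, each weight is multiplied by the number of elements
  whose order divides the \<open>A\<close>-part of \<open>n\<close>; the group enters only through
  these numbers.\<close>

lemma (in group) R_sum_eq_weighted_roots:
  assumes fin: "finite (carrier G)" and "n > 0"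
  shows "R_sum G n r r
    = (\<Sum>A\<in>Pow (prime_factors n). hall_weight r n A * real (card (pow_roots G (hall_part n A))))"
proof -
  let ?X = "{x \<in> carrier G. ord x dvd n}"
  have finX: "finite ?X" using fin by simp
  have "R_sum G n r r = (\<Sum>x\<in>?X. (real (ord x) / real (totient (ord x))) powr r)"
    unfolding R_sum_def by (simp add: powr_divide)
  also have "\<dots> = (\<Sum>x\<in>?X. \<Sum>A\<in>Pow (prime_factors n).
      hall_weight r n A * (if ord x dvd hall_part n A then 1 else 0))"
    using assms(2) by (intro sum.cong totient_ratio_powr_expansion) auto
  also have "\<dots> = (\<Sum>A\<in>Pow (prime_factors n). \<Sum>x\<in>?X.
      hall_weight r n A * (if ord x dvd hall_part n A then 1 else 0))"
    by (rule sum.swap)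
  also have "\<dots> = (\<Sum>A\<in>Pow (prime_factors n). hall_weight r n A * real (card (pow_roots G (hall_part n A))))"
  proof (rule sum.cong[OF refl])
    fix A assume "A \<in> Pow (prime_factors n)"
    then have "hall_part n A dvd n" using hall_part_mult(1)[OF assms(2), of A] dvdI by blast
    then have "?X \<inter> {x. ord x dvd hall_part n A} = pow_roots G (hall_part n A)"
      by (auto simp: mem_pow_roots_iff intro: dvd_trans)
    then have "(\<Sum>x\<in>?X. if ord x dvd hall_part n A then 1 else 0) = real (card (pow_roots G (hall_part n A)))"
      using finX by (simp add: sum.If_cases)
    then show "(\<Sum>x\<in>?X. hall_weight r n A * (if ord x dvd hall_part n A then 1 else 0))
        = hall_weight r n A * real (card (pow_roots G (hall_part n A)))"
      unfolding sum_distrib_left[symmetric] by simp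
  qed
  finally show ?thesis .
qed

section \<open>Comparison with the cyclic group\<close>

lemma order_cyclic_group: "order (cyclic_group N) = N"
  if "N > 0"
  using that by (simp add: order_def carrier_integer_mod_group)

text \<open>Additively, m x is a multiple of N = m q exactly when q divides x, and there are m
  multiples of q from 0 to below N.\<close>

lemma card_pow_roots_cyclic_group:
  assumes "N > 0" "m dvd N"
  shows "card (pow_roots (cyclic_group N) m) = m"
proof -
  obtain q where q: "N = m * q" using assms(2) by blast
  have pos: "m > 0" "q > 0" using assms(1) q by (auto intro: Nat.gr0I)
  have "pow_roots (cyclic_group N) m = (\<lambda>i. int q * i) ` {0..<int m}"
  proof (intro equalityI subsetI)
    fix x assume "x \<in> pow_roots (cyclic_group N) m"
    then have x: "0 \<le> x" "x < int m * int q" "int m * int q dvd int m * x"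
      using assms(1) by (auto simp: pow_roots_def carrier_integer_mod_group q)
    then have "int q dvd x" using pos by simp
    then obtain i where i: "x = int q * i" by blast
    have "0 \<le> i" using x(1) pos unfolding i by (simp add: zero_le_mult_iff)
    moreover have "i < int m" using x(2) pos unfolding i by (simp add: mult.commute)
    ultimately show "x \<in> (\<lambda>i. int q * i) ` {0..<int m}" using i by (intro image_eqI[where x = i]) auto
  next
    fix x assume "x \<in> (\<lambda>i. int q * i) ` {0..<int m}"
    then obtain i where "x = int q * i" "i \<in> {0..<int m}" by (rule imageE)
    then have i: "x = int q * i" "0 \<le> i" "i < int m" by auto
    have "x < int m * int q" unfolding i(1) using i(3) pos by (simp add: mult.commute)
    then show "x \<in> pow_roots (cyclic_group N) m"
      using i assms(1) by (simp add: pow_roots_def carrier_integer_mod_group q)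
  qed
  moreover have "inj_on (\<lambda>i. int q * i) {0..<int m}" using pos by (simp add: inj_on_def)
  ultimately show ?thesis by (simp add: card_image)
qed

theorem (in group) T_diff_nonneg_and_zero_iff:
  assumes fin: "finite (carrier G)" and r: "r < 0" and n0: "0 < n" and n: "n dvd order G"
  shows "T_diff G n r r \<ge> 0"
    and "T_diff G n r r = 0 \<longleftrightarrow>
      (\<exists>!H. subgroup H G \<and> card H = n) \<and>
      (\<forall>H. subgroup H G \<and> card H = n \<longrightarrow> nilpotent_group (G\<lparr>carrier := H\<rparr>))"
proof -
  define excess where "excess A = hall_weight r n A *
    (real (card (pow_roots G (hall_part n A))) - real (hall_part n A))" for A
  have pos: "order G > 0" using fin order_gt_0_iff_finite by simp
  have hall_dvd: "hall_part n A dvd order G" if "A \<subseteq> prime_factors n" for A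
    using hall_part_mult(1)[OF n0 that] n dvd_trans dvd_triv_left by metis
  interpret C: group "cyclic_group (order G)" by simp
  have "finite (carrier (cyclic_group (order G)))" using pos by (simp add: carrier_integer_mod_group)
  from C.R_sum_eq_weighted_roots[OF this n0]
  have "R_sum (cyclic_group (order G)) n r r
      = (\<Sum>A\<in>Pow (prime_factors n). hall_weight r n A * real (hall_part n A))"
    using card_pow_roots_cyclic_group[OF pos hall_dvd] by simp
  then have T: "T_diff G n r r = (\<Sum>A\<in>Pow (prime_factors n). excess A)"
    unfolding T_diff_def R_sum_eq_weighted_roots[OF fin n0] excess_def
    by (simp add: sum_subtractf right_diff_distrib)
  have excess: "excess A \<ge> 0"
    "excess A = 0 \<longleftrightarrow> card (pow_roots G (hall_part n A)) = hall_part n A"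
    if A: "A \<in> Pow (prime_factors n)" for A
  proof -
    have w: "hall_weight r n A > 0" using hall_weight_pos[OF r] A by simp
    have "\<one> \<in> pow_roots G (hall_part n A)" by (simp add: pow_roots_def)
    then have "card (pow_roots G (hall_part n A)) > 0"
      using finite_pow_roots[OF fin] card_gt_0_iff by blast
    \<comment> \<open>Frobenius' theorem gives only divisibility; the bound follows because the
      identity is a solution and the count is positive.\<close>
    then have "hall_part n A \<le> card (pow_roots G (hall_part n A))"
      using frobenius[OF fin hall_dvd[of A]] A by (intro dvd_imp_le) auto
    then show "excess A \<ge> 0" using w by (simp add: excess_def)
    show "excess A = 0 \<longleftrightarrow> card (pow_roots G (hall_part n A)) = hall_part n A"
      using w by (simp add: excess_def)
  qed
  show "T_diff G n r r \<ge> 0" unfolding T by (rule sum_nonneg[OF excess(1)])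
  have "T_diff G n r r = 0 \<longleftrightarrow> (\<forall>A\<in>Pow (prime_factors n). excess A = 0)"
    unfolding T by (rule sum_nonneg_eq_0_iff[OF _ excess(1)]) simp
  also have "\<dots> \<longleftrightarrow> (\<forall>A\<in>Pow (prime_factors n). card (pow_roots G (hall_part n A)) = hall_part n A)"
    using excess(2) by (intro ball_cong refl)
  \<comment> \<open>One direction takes A = {p}. For the other, the counts at prime powers are
    turned into subgroups, and these are multiplied over the primes in \<open>A\<close>.\<close>
  also have "\<dots> \<longleftrightarrow> (\<forall>p\<in>prime_factors n.
      card (pow_roots G (p ^ multiplicity p n)) = p ^ multiplicity p n)"
  proof
    assume *: "\<forall>A\<in>Pow (prime_factors n). card (pow_roots G (hall_part n A)) = hall_part n A"
    show "\<forall>p\<in>prime_factors n. card (pow_roots G (p ^ multiplicity p n)) = p ^ multiplicity p n"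
    proof
      fix p assume "p \<in> prime_factors n"
      then have "{p} \<in> Pow (prime_factors n)" by simp
      from bspec[OF * this]
      show "card (pow_roots G (p ^ multiplicity p n)) = p ^ multiplicity p n"
        by (simp add: hall_part_def)
    qed
  next
    assume *: "\<forall>p\<in>prime_factors n. card (pow_roots G (p ^ multiplicity p n)) = p ^ multiplicity p n"
    have roots: "roots_subgroup G (p ^ multiplicity p n)"
      if "Factorial_Ring.prime p" "p dvd n" for p
    proof (rule roots_subgroup_prime_power[OF fin that(1)])
      show "p ^ multiplicity p n dvd order G" by (rule dvd_trans[OF multiplicity_dvd n])
      show "card (pow_roots G (p ^ multiplicity p n)) = p ^ multiplicity p n"
        using * that n0 by (simp add: prime_factors_dvd)
    qed
    show "\<forall>A\<in>Pow (prime_factors n). card (pow_roots G (hall_part n A)) = hall_part n A"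
    proof
      fix A assume "A \<in> Pow (prime_factors n)"
      then have A: "A \<subseteq> prime_factors n" "prime_factors n - A \<subseteq> prime_factors n" by auto
      note h = hall_part_mult[OF n0 A(1)]
      have "roots_subgroup G (hall_part n A)"
        by (rule roots_subgroup_hall_divisor[OF h(3) hall_part_mult(3)[OF n0 A(2)] h(2)],
            unfold h(1)[symmetric]) (rule roots)
      then show "card (pow_roots G (hall_part n A)) = hall_part n A" by (simp add: roots_subgroup_def)
    qed
  qed
  also have "\<dots> \<longleftrightarrow> (\<exists>!H. subgroup H G \<and> card H = n) \<and>
      (\<forall>H. subgroup H G \<and> card H = n \<longrightarrow> nilpotent_group (G\<lparr>carrier := H\<rparr>))"
    by (rule card_prime_power_roots_iff_unique_nilpotent[OF fin n0 n])
  finally show "T_diff G n r r = 0 \<longleftrightarrow> (\<exists>!H. subgroup H G \<and> card H = n) \<and>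
      (\<forall>H. subgroup H G \<and> card H = n \<longrightarrow> nilpotent_group (G\<lparr>carrier := H\<rparr>))" .
qed

lemma (in group) R_sum_order:
  "R_sum G (order G) r r = (\<Sum>x\<in>carrier G. (real (ord x) / real (totient (ord x))) powr r)"
proof -
  have "{x \<in> carrier G. ord x dvd order G} = carrier G" using ord_dvd_group_order by blast
  then show ?thesis unfolding R_sum_def by (simp add: powr_divide)
qed

lemma (in group) subgroup_card_order_iff:
  "finite (carrier G) \<Longrightarrow> subgroup H G \<and> card H = order G \<longleftrightarrow> H = carrier G"
  using card_subset_eq[of "carrier G" H] subgroup.subset[of H G] subgroup_self
  by (auto simp: order_def)

theorem mainTheorem5:
  fixes G :: "('a, 'b) monoid_scheme" and n :: nat and r s :: real
  assumes "group G" and "finite (carrier G)"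
    and "s = r" and "r < 0"
    and "0 < n" and "n dvd order G"
  shows "T_diff G n r s \<ge> 0
      \<and> (T_diff G n r s = 0 \<longleftrightarrow>
           (\<exists>!H. subgroup H G \<and> card H = n) \<and>
           (\<forall>H. subgroup H G \<and> card H = n \<longrightarrow> nilpotent_group (G\<lparr>carrier := H\<rparr>)))
      \<and> (\<Sum>x \<in> carrier G. (real (group.ord G x) / real (totient (group.ord G x))) powr r)
          \<ge> (\<Sum>x \<in> carrier (cyclic_group (order G)).
               (real (group.ord (cyclic_group (order G)) x)
                 / real (totient (group.ord (cyclic_group (order G)) x))) powr r)
      \<and> ((\<Sum>x \<in> carrier G. (real (group.ord G x) / real (totient (group.ord G x))) powr r)
          = (\<Sum>x \<in> carrier (cyclic_group (order G)).
               (real (group.ord (cyclic_group (order G)) x)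
                 / real (totient (group.ord (cyclic_group (order G)) x))) powr r)
         \<longleftrightarrow> nilpotent_group G)"
proof -
  interpret group G by fact
  interpret C: group "cyclic_group (order G)" by simp
  have pos: "order G > 0" using assms(2) order_gt_0_iff_finite by simp
  note part = T_diff_nonneg_and_zero_iff[OF assms(2,4-6), folded assms(3)]
  note full = T_diff_nonneg_and_zero_iff[OF assms(2,4) pos dvd_refl]
  have T: "T_diff G (order G) r r
      = (\<Sum>x \<in> carrier G. (real (ord x) / real (totient (ord x))) powr r)
      - (\<Sum>x \<in> carrier (cyclic_group (order G)). (real (C.ord x) / real (totient (C.ord x))) powr r)"
    unfolding T_diff_def R_sum_order
    using C.R_sum_order[of r, unfolded order_cyclic_group[OF pos]] by simp
  \<comment> \<open>The carrier is the only subgroup of order |G|, so the condition reduces to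
    nilpotency of \<open>G\<close> itself.\<close>
  have nil: "T_diff G (order G) r r = 0 \<longleftrightarrow> nilpotent_group G"
    unfolding full(2) subgroup_card_order_iff[OF assms(2)] by simp
  show ?thesis using part full(1) nil unfolding T assms(3) by simp
qed

end
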